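(* Let $X:\mathbb R^n\times\mathbb R^k\to\mathbb R^n$ be smooth, let $M\subset\mathbb R^n$ be a regular (embedded) submanifold that is invariant under the flow of the control system $\dot x=X(x,u)$, and let $\tilde V:\mathbb R^n\to\mathbb R$ be a smooth non-negative function with $M=\tilde V^{-1}(0)$. Put $\tilde X(x,u)=X(x,u)-\nabla\tilde V(x)$. Let $x_0:[0,\infty)\to M$ and $u_0:[0,\infty)\to\mathbb R^k$ be smooth with $\dot x_0(t)=\tilde X(x_0(t),u_0(t))$ for all $t\ge0$. Suppose that a linear feedback controller $\Delta u=-K(t)\Delta x$, with $K:[0,\infty)\to\mathbb R^{k\times n}$ smooth, exponentially stabilizes the origin for the linear time-varying system $$\Delta\dot x=A(t)\Delta x+B(t)\Delta u,\qquad A(t)=\frac{\partial\tilde X}{\partial x}(x_0(t),u_0(t)),\quad B(t)=\frac{\partial\tilde X}{\partial u}(x_0(t),u_0(t)).$$ Let $B_r=\{z\in\mathbb R^n\mid\|z\|<r\}$ for some $r>0$ and let $f:B_r\times[0,\infty)\to\mathbb R^n$ be defined by $$f(z,t)=\tilde X\bigl(x_0(t)+z,\,u_0(t)-K(t)z\bigr)-\tilde X(x_0(t),u_0(t)).$$ If the derivative $\frac{\partial f}{\partial z}(z,t)$ is bounded and Lipschitz (in $z$) on $B_r$ uniformly in $t$, then the controller $$u(x,t)=u_0(t)-K(t)(x-x_0(t))$$ enables the system $\dot x=X(x,u)$, $x\in M$, on $M$ to track the reference trajectory $x_0(t)$ exponentially.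
   Context: $M$ is invariant under the flow of $\dot x=X(x,u)$ means: for every control input, trajectories starting in $M$ stay in $M$, so the system restricts to a control system on $M$. Since $\nabla\tilde V=0$ on $M$, $\dot x=\tilde X(x,u)$ and $\dot x=X(x,u)$ have the same restriction to $M$. Exponential stability of the origin of a time-varying system $\dot z=g(z,t)$: there are $C,c,\delta>0$ such that for all $t_0\ge0$, every solution with $\|z(t_0)\|<\delta$ satisfies $\|z(t)\|\le Ce^{-c(t-t_0)}\|z(t_0)\|$ for all $t\ge t_0$; a feedback exponentially stabilizes the origin if the closed-loop system has this property. A controller $u(x,t)$ enables the system on $M$ to track $x_0(t)$ exponentially if there are $C,c,\delta>0$ such that for all $t_0\ge0$, every closed-loop solution with $x(t_0)\in M$ and $\|x(t_0)-x_0(t_0)\|<\delta$ satisfies $\|x(t)-x_0(t)\|\le Ce^{-c(t-t_0)}\|x(t_0)-x_0(t_0)\|$ for all $t\ge t_0$. Norms are Euclidean; stability and tracking are understood locally. *)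

theory Defs
  imports "HOL-Analysis.Analysis"
begin

(* Derivatives are taken within S, so that one definition serves both open sets and
   {0..}, where it means one-sided differentiability at 0. The definition is meant
   for sets on which the derivative within S is unique at every point. *)
primrec Ck_on :: "nat \<Rightarrow> 'a::euclidean_space set \<Rightarrow> ('a \<Rightarrow> 'b::real_normed_vector) \<Rightarrow> bool" where
  "Ck_on 0 S f \<longleftrightarrow> continuous_on S f"
| "Ck_on (Suc k) S f \<longleftrightarrow> f differentiable_on S \<and>
     (\<forall>v. Ck_on k S (\<lambda>x. frechet_derivative f (at x within S) v))"

definition smooth_on :: "'a::euclidean_space set \<Rightarrow> ('a \<Rightarrow> 'b::real_normed_vector) \<Rightarrow> bool" where
  "smooth_on S f \<longleftrightarrow> (\<forall>k. Ck_on k S f)"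

definition grad :: "(real^'n \<Rightarrow> real) \<Rightarrow> real^'n \<Rightarrow> real^'n" where
  "grad V x = (\<chi> i. frechet_derivative V (at x) (axis i 1))"

(* Regular submanifold without boundary, all components of the same dimension d,
   given by slice charts; closedness is not required. *)
definition embedded_submanifold :: "'a::euclidean_space set \<Rightarrow> bool" where
  "embedded_submanifold M \<longleftrightarrow>
     (\<exists>d. \<forall>p\<in>M. \<exists>U W \<phi> \<psi> (L::'a set).
        open U \<and> p \<in> U \<and> open W \<and> homeomorphism U W \<phi> \<psi> \<and>
        smooth_on U \<phi> \<and> smooth_on W \<psi> \<and>
        subspace L \<and> dim L = d \<and> \<phi> ` (U \<inter> M) = W \<inter> L)"

definition solution_on :: "(real^'n \<Rightarrow> real \<Rightarrow> real^'n) \<Rightarrow> real set \<Rightarrow> (real \<Rightarrow> real^'n) \<Rightarrow> bool" where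
  "solution_on g J x \<longleftrightarrow> (\<forall>t\<in>J. (x has_vector_derivative g (x t) t) (at t within J))"

(* Control inputs are continuous functions of time, so that trajectories are
   classical solutions. *)
definition control_invariant ::
    "(real^'n \<Rightarrow> real^'k \<Rightarrow> real^'n) \<Rightarrow> (real^'n) set \<Rightarrow> bool" where
  "control_invariant X M \<longleftrightarrow>
     (\<forall>u x t0 t1. continuous_on {t0..t1} u \<longrightarrow>
        solution_on (\<lambda>z t. X z (u t)) {t0..t1} x \<longrightarrow> x t0 \<in> M \<longrightarrow>
        (\<forall>t\<in>{t0..t1}. x t \<in> M))"

definition solution_from ::
    "(real^'n \<Rightarrow> real \<Rightarrow> real^'n) \<Rightarrow> real \<Rightarrow> real set \<Rightarrow> (real \<Rightarrow> real^'n) \<Rightarrow> bool" where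
  "solution_from g t0 J x \<longleftrightarrow>
     is_interval J \<and> t0 \<in> J \<and> J \<subseteq> {t0..} \<and> solution_on g J x"

(* Forward-maximal solutions. J = {t0} is admitted in solution_from, so by Zorn every
   initial value has a maximal solution: statements about all maximal solutions
   are never vacuous. *)
definition maximal_solution ::
    "(real^'n \<Rightarrow> real \<Rightarrow> real^'n) \<Rightarrow> real \<Rightarrow> real set \<Rightarrow> (real \<Rightarrow> real^'n) \<Rightarrow> bool" where
  "maximal_solution g t0 J x \<longleftrightarrow> solution_from g t0 J x \<and>
     \<not> (\<exists>J' y. solution_from g t0 J' y \<and> J \<subset> J' \<and> (\<forall>t\<in>J. y t = x t))"

(* "Every solution satisfies the estimate for all t \<ge> t0" includes that the
   solution exists for all t \<ge> t0, hence the clause J = {t0..}. *)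
definition exponentially_stable :: "(real^'n \<Rightarrow> real \<Rightarrow> real^'n) \<Rightarrow> bool" where
  "exponentially_stable g \<longleftrightarrow>
     (\<exists>C>0. \<exists>c>0. \<exists>\<delta>>0. \<forall>t0\<ge>0. \<forall>J z.
        maximal_solution g t0 J z \<longrightarrow> norm (z t0) < \<delta> \<longrightarrow>
        J = {t0..} \<and> (\<forall>t\<ge>t0. norm (z t) \<le> C * exp (- c * (t - t0)) * norm (z t0)))"

definition exponentially_tracks_on ::
    "(real^'n) set \<Rightarrow> (real^'n \<Rightarrow> real^'k \<Rightarrow> real^'n) \<Rightarrow> (real^'n \<Rightarrow> real \<Rightarrow> real^'k) \<Rightarrow>
     (real \<Rightarrow> real^'n) \<Rightarrow> bool" where
  "exponentially_tracks_on M X u x0 \<longleftrightarrow>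
     (\<exists>C>0. \<exists>c>0. \<exists>\<delta>>0. \<forall>t0\<ge>0. \<forall>J x.
        maximal_solution (\<lambda>z t. X z (u z t)) t0 J x \<longrightarrow> x t0 \<in> M \<longrightarrow>
        norm (x t0 - x0 t0) < \<delta> \<longrightarrow>
        J = {t0..} \<and>
        (\<forall>t\<ge>t0. norm (x t - x0 t) \<le> C * exp (- c * (t - t0)) * norm (x t0 - x0 t0)))"

end

theory Submission
  imports Defs
begin

text \<open>
  Invariance reduces the claim to \<open>Xt\<close>: a closed-loop trajectory of \<open>X\<close> that starts in \<open>M\<close> is a
  trajectory under a continuous control input, so it stays in \<open>M\<close>; there \<open>V\<close> attains its minimum,
  its gradient vanishes, and \<open>X\<close> and \<open>Xt\<close> agree. Hence the error \<open>z = x - x0\<close> satisfies \<open>z' = f z t\<close>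
  while it is small. By the chain rule (\<open>closed_loop_linearization\<close>) the derivative of \<open>f\<close> at
  \<open>z = 0\<close> is the matrix \<open>A t - B t ** K t\<close> of the stable linear closed loop, and the uniform Lipschitz
  bound on the Jacobian makes the remainder \<open>O(norm z ^ 2)\<close> uniformly in time
  (\<open>jacobian_lipschitz_remainder\<close>).

  What remains is Lyapunov's indirect method for time-varying systems,
  \<open>exponential_decay_of_linearization\<close>. Instead of a converse Lyapunov function, the proof compares
  \<open>z\<close> on a window of fixed length \<open>T\<close> with the solution \<open>w\<close> of the linear system that agrees with
  \<open>z\<close> at the start of the window. If \<open>T\<close> is large, \<open>w\<close> shrinks by a factor 4; by Gronwall's
  inequality \<open>z - w\<close> is at most a quarter of the initial error as long as \<open>z\<close> is small. So \<open>z\<close>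
  halves on every window, decays exponentially, and therefore never ceases to be small
  (\<open>continuous_bootstrap\<close>).

  The definitions of stability and tracking speak about maximal solutions, which adds two
  existence questions. The comparison solution \<open>w\<close> comes from Zorn's lemma alone
  (\<open>maximal_solution_exists\<close>): the stability hypothesis already says that a maximal solution of the
  linear system with small initial value is global. The closed-loop solution is
  global because it stays bounded on bounded time intervals and the field is locally Lipschitz
  (\<open>maximal_solution_global\<close>); this rests on the Picard-Lindeloef theorem for globally Lipschitz
  fields (\<open>picard_global\<close>).
\<close>

section \<open>Gronwall estimates\<close>

text \<open>Squaring avoids the points where the norm is not differentiable: the derivative of
  \<open>(norm e)\<^sup>2\<close> is at most \<open>2 * k * (norm e)\<^sup>2 + 2 * \<eta> * norm e\<close>, and the mixed term is absorbed by
  \<open>2 * \<eta> * norm e \<le> \<eta>\<^sup>2 + (norm e)\<^sup>2\<close>, which is where the rate \<open>2 * k + 1\<close> comes from.\<close>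

lemma gronwall_square:
  fixes e e' :: "real \<Rightarrow> 'a::real_inner"
  assumes ab: "a \<le> b" and k: "0 \<le> k"
    and der: "\<And>t. t \<in> {a..b} \<Longrightarrow> (e has_vector_derivative e' t) (at t within {a..b})"
    and bound: "\<And>t. t \<in> {a..b} \<Longrightarrow> norm (e' t) \<le> k * norm (e t) + \<eta>"
  shows "(norm (e b))\<^sup>2 \<le> ((norm (e a))\<^sup>2 + \<eta>\<^sup>2 * (b - a)) * exp ((2 * k + 1) * (b - a))"
proof -
  define \<phi> where "\<phi> t = (e t \<bullet> e t) * exp (- (2 * k + 1) * (t - a)) - \<eta>\<^sup>2 * (t - a)" for t
  have cont: "continuous_on {a..b} e"
    using der by (meson continuous_on_eq_continuous_within has_vector_derivative_continuous)
  have "\<phi> b \<le> \<phi> a"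
  proof (rule DERIV_nonpos_imp_decreasing_open[OF ab])
    show "continuous_on {a..b} \<phi>"
      unfolding \<phi>_def by (intro continuous_intros cont)
    fix t assume t: "a < t" "t < b"
    define E where "E = exp (- (2 * k + 1) * (t - a))"
    have E: "0 < E" "E \<le> 1"
      using t k by (auto simp: E_def mult_nonpos_nonneg)
    have dt: "(e has_vector_derivative e' t) (at t)"
      using der[of t] t by (simp add: at_within_Icc_at)
    have "((\<lambda>t. e t \<bullet> e t) has_vector_derivative (e t \<bullet> e' t + e' t \<bullet> e t)) (at t)"
      by (rule bounded_bilinear.has_vector_derivative[OF bounded_bilinear_inner dt dt])
    then have sq: "((\<lambda>t. e t \<bullet> e t) has_real_derivative 2 * (e t \<bullet> e' t)) (at t)"
      by (simp add: has_real_derivative_iff_has_vector_derivative inner_commute)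
    have D: "(\<phi> has_real_derivative (2 * (e t \<bullet> e' t) - (2 * k + 1) * (e t \<bullet> e t)) * E - \<eta>\<^sup>2) (at t)"
      unfolding \<phi>_def E_def
      by (rule derivative_eq_intros sq refl | simp add: algebra_simps)+
    have "2 * (e t \<bullet> e' t) \<le> 2 * (norm (e t) * norm (e' t))"
      using norm_cauchy_schwarz by simp
    also have "\<dots> \<le> 2 * (norm (e t) * (k * norm (e t) + \<eta>))"
      using bound[of t] t by (intro mult_left_mono) auto
    also have "\<dots> \<le> (2 * k + 1) * (norm (e t))\<^sup>2 + \<eta>\<^sup>2"
      using sum_squares_bound[of "norm (e t)" \<eta>] by (simp add: power2_eq_square algebra_simps)
    finally have "2 * (e t \<bullet> e' t) - (2 * k + 1) * (e t \<bullet> e t) \<le> \<eta>\<^sup>2"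
      by (simp add: power2_norm_eq_inner)
    then have "(2 * (e t \<bullet> e' t) - (2 * k + 1) * (e t \<bullet> e t)) * E \<le> \<eta>\<^sup>2 * E"
      using E by (intro mult_right_mono) auto
    also have "\<dots> \<le> \<eta>\<^sup>2"
      using E by (simp add: mult_left_le)
    finally show "\<exists>y. DERIV \<phi> t :> y \<and> y \<le> 0"
      using D by auto
  qed
  then have "(norm (e b))\<^sup>2 * exp (- (2 * k + 1) * (b - a)) \<le> (norm (e a))\<^sup>2 + \<eta>\<^sup>2 * (b - a)"
    by (simp add: \<phi>_def power2_norm_eq_inner)
  then have "(norm (e b))\<^sup>2 * exp (- (2 * k + 1) * (b - a)) * exp ((2 * k + 1) * (b - a))
      \<le> ((norm (e a))\<^sup>2 + \<eta>\<^sup>2 * (b - a)) * exp ((2 * k + 1) * (b - a))"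
    by (rule mult_right_mono) simp
  moreover have "exp (- (2 * k + 1) * (b - a)) * exp ((2 * k + 1) * (b - a)) = 1"
    by (simp only: mult_minus_left exp_minus_inverse mult.commute[of "exp (- _)"])
  ultimately show ?thesis
    by (simp only: mult.assoc mult_1_right)
qed

text \<open>A coarser form without squares: spending another \<open>exp (b - a)\<close> absorbs the factor
  \<open>b - a\<close> in front of \<open>\<eta>\<^sup>2\<close>.\<close>

lemma gronwall:
  fixes e e' :: "real \<Rightarrow> 'a::real_inner"
  assumes ab: "a \<le> b" and k: "0 \<le> k" and \<eta>: "0 \<le> \<eta>"
    and der: "\<And>t. t \<in> {a..b} \<Longrightarrow> (e has_vector_derivative e' t) (at t within {a..b})"
    and bound: "\<And>t. t \<in> {a..b} \<Longrightarrow> norm (e' t) \<le> k * norm (e t) + \<eta>"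
  shows "norm (e b) \<le> (norm (e a) + \<eta>) * exp ((k + 1) * (b - a))"
proof (rule power2_le_imp_le)
  have "(norm (e a))\<^sup>2 * 1 + \<eta>\<^sup>2 * (b - a) \<le> (norm (e a))\<^sup>2 * exp (b - a) + \<eta>\<^sup>2 * exp (b - a)"
  proof -
    have "1 \<le> exp (b - a)" "b - a \<le> exp (b - a)"
      using ab exp_ge_add_one_self[of "b - a"] by linarith+
    then show ?thesis by (intro add_mono mult_left_mono) auto
  qed
  also have "\<dots> \<le> (norm (e a) + \<eta>)\<^sup>2 * exp (b - a)"
    using \<eta> by (simp add: power2_eq_square algebra_simps)
  finally have "((norm (e a))\<^sup>2 + \<eta>\<^sup>2 * (b - a)) * exp ((2 * k + 1) * (b - a))
      \<le> ((norm (e a) + \<eta>)\<^sup>2 * exp (b - a)) * exp ((2 * k + 1) * (b - a))"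
    by (intro mult_right_mono) auto
  also have "\<dots> = (norm (e a) + \<eta>)\<^sup>2 * exp (2 * ((k + 1) * (b - a)))"
    by (simp only: mult.assoc flip: exp_add) (simp add: algebra_simps)
  also have "\<dots> = ((norm (e a) + \<eta>) * exp ((k + 1) * (b - a)))\<^sup>2"
    by (simp add: power_mult_distrib exp_double)
  finally show "(norm (e b))\<^sup>2 \<le> ((norm (e a) + \<eta>) * exp ((k + 1) * (b - a)))\<^sup>2"
    using gronwall_square[OF ab k der bound] by linarith
  show "0 \<le> (norm (e a) + \<eta>) * exp ((k + 1) * (b - a))"
    using \<eta> by simp
qed

section \<open>Existence and continuation of solutions\<close>

text \<open>Picard-Lindeloef on a whole compact interval in one application of Banach's fixed point
  theorem. The weight \<open>exp (- l * (t - a))\<close> makes the Picard operator a contraction by the factor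
  \<open>\<bar>L\<bar> / l\<close> however long the interval is, so that no patching of short-time solutions is needed. The
  fixed point \<open>v\<close> is the weighted solution \<open>exp (- l * (t - a)) *\<^sub>R y t\<close>, extended to the real line by
  clamping the time to \<open>{a..b}\<close>.\<close>

lemma picard_global:
  fixes h :: "'a::euclidean_space \<Rightarrow> real \<Rightarrow> 'a"
  assumes ab: "a \<le> b"
    and cont: "continuous_on (UNIV \<times> {a..b}) (\<lambda>(x, t). h x t)"
    and lip: "\<And>x y t. t \<in> {a..b} \<Longrightarrow> norm (h x t - h y t) \<le> L * norm (x - y)"
  shows "\<exists>y. y a = p \<and> (\<forall>t\<in>{a..b}. (y has_vector_derivative h (y t) t) (at t within {a..b}))"
proof -
  define l where "l = 2 * (\<bar>L\<bar> + 1)"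
  have l: "l > 0" "\<bar>L\<bar> / l \<le> 1/2"
    by (auto simp: l_def field_simps)
  define G where "G v t = exp (- l * (t - a)) *\<^sub>R
      (p + integral {a..t} (\<lambda>s. h (exp (l * (s - a)) *\<^sub>R v s) s))" for v :: "real \<Rightarrow> 'a" and t
  have comp: "continuous_on {a..b} (\<lambda>s. h (exp (l * (s - a)) *\<^sub>R v s) s)"
    if "continuous_on {a..b} v" for v :: "real \<Rightarrow> 'a"
  proof -
    have "continuous_on {a..b} ((\<lambda>(x, t). h x t) \<circ> (\<lambda>s. (exp (l * (s - a)) *\<^sub>R v s, s)))"
      by (rule continuous_on_compose[OF _ continuous_on_subset[OF cont]])
         (use that in \<open>auto intro!: continuous_intros\<close>)
    then show ?thesis by (simp add: o_def)
  qed
  have contG: "continuous_on (cbox a b) (G v)" if "continuous_on {a..b} v" for v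
    unfolding G_def cbox_interval
    by (intro continuous_intros indefinite_integral_continuous_1 integrable_continuous_real comp that)
  have "\<exists>g::real \<Rightarrow>\<^sub>C 'a. \<forall>t. apply_bcontfun g t = G (apply_bcontfun v) (clamp a b t)"
    for v :: "real \<Rightarrow>\<^sub>C 'a"
  proof -
    obtain g :: "real \<Rightarrow>\<^sub>C 'a" where
      "\<And>t. apply_bcontfun g t = G (apply_bcontfun v) (clamp a b t)"
      using continuous_on_cbox_bcontfunE[OF contG[OF continuous_on_apply_bcontfun]] by blast
    then show ?thesis by blast
  qed
  then obtain \<Phi> :: "(real \<Rightarrow>\<^sub>C 'a) \<Rightarrow> (real \<Rightarrow>\<^sub>C 'a)" where
    \<Phi>: "\<And>v t. apply_bcontfun (\<Phi> v) t = G (apply_bcontfun v) (clamp a b t)"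
    by metis
  have diffG: "norm (G (apply_bcontfun v) t - G (apply_bcontfun w) t) \<le> 1/2 * dist v w"
    if t: "t \<in> {a..b}" for v w t
  proof -
    let ?f = "\<lambda>v s. h (exp (l * (s - a)) *\<^sub>R apply_bcontfun v s) s"
    let ?g = "\<lambda>s. \<bar>L\<bar> * dist v w * exp (l * (s - a))"
    have int: "?f v integrable_on {a..t}" for v
      using t by (intro integrable_continuous_real continuous_on_subset[OF comp]) auto
    have "(?g has_integral \<bar>L\<bar> * dist v w / l * exp (l * (t - a)) - \<bar>L\<bar> * dist v w / l * exp (l * (a - a))) {a..t}"
      using t l
      by (intro fundamental_theorem_of_calculus)
         (auto intro!: derivative_eq_intros simp flip: has_real_derivative_iff_has_vector_derivative)
    then have "(?g has_integral \<bar>L\<bar> * dist v w / l * (exp (l * (t - a)) - 1)) {a..t}"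
      by (simp add: right_diff_distrib)
    then have gint: "?g integrable_on {a..t}"
      and gval: "integral {a..t} ?g = \<bar>L\<bar> * dist v w / l * (exp (l * (t - a)) - 1)"
      by (rule has_integral_integrable, rule integral_unique)
    have "norm (integral {a..t} (\<lambda>s. ?f v s - ?f w s)) \<le> integral {a..t} ?g"
    proof (rule integral_norm_bound_integral[OF _ gint])
      show "(\<lambda>s. ?f v s - ?f w s) integrable_on {a..t}"
        by (intro integrable_diff int)
      fix s assume "s \<in> {a..t}"
      then have s: "s \<in> {a..b}" using t by auto
      have "norm (?f v s - ?f w s) \<le> L * norm (exp (l * (s - a)) *\<^sub>R (apply_bcontfun v s - apply_bcontfun w s))"
        using lip[OF s] by (simp add: scaleR_diff_right)
      also have "\<dots> = L * dist (apply_bcontfun v s) (apply_bcontfun w s) * exp (l * (s - a))"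
        by (simp add: dist_norm)
      also have "\<dots> \<le> \<bar>L\<bar> * dist v w * exp (l * (s - a))"
        by (intro mult_mono dist_bounded) auto
      finally show "norm (?f v s - ?f w s) \<le> ?g s" .
    qed
    also have "\<dots> \<le> \<bar>L\<bar> * dist v w / l * exp (l * (t - a))"
      unfolding gval using l by (intro mult_left_mono) auto
    finally have *: "norm (integral {a..t} (\<lambda>s. ?f v s - ?f w s)) \<le> \<bar>L\<bar> * dist v w / l * exp (l * (t - a))" .
    have "G (apply_bcontfun v) t - G (apply_bcontfun w) t
        = exp (- l * (t - a)) *\<^sub>R integral {a..t} (\<lambda>s. ?f v s - ?f w s)"
      by (simp add: G_def integral_diff[OF int int] scaleR_diff_right[symmetric])
    then have "norm (G (apply_bcontfun v) t - G (apply_bcontfun w) t)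
        = exp (- l * (t - a)) * norm (integral {a..t} (\<lambda>s. ?f v s - ?f w s))"
      by simp
    also have "\<dots> \<le> exp (- l * (t - a)) * (\<bar>L\<bar> * dist v w / l * exp (l * (t - a)))"
      by (intro mult_left_mono *) auto
    also have "\<dots> = (exp (l * (t - a)) * exp (- (l * (t - a)))) * (\<bar>L\<bar> / l * dist v w)"
      by simp
    also have "\<dots> = \<bar>L\<bar> / l * dist v w"
      by (simp only: exp_minus_inverse mult_1_left)
    also have "\<dots> \<le> 1/2 * dist v w"
      using l by (intro mult_right_mono) auto
    finally show ?thesis .
  qed
  have clamp_in: "clamp a b t \<in> {a..b}" for t
    using clamp_in_interval[of a b t] ab by simp
  have "\<exists>!v. v \<in> UNIV \<and> \<Phi> v = v"
  proof (rule Banach_fix[of UNIV "1/2"])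
    show "dist (\<Phi> v) (\<Phi> w) \<le> 1/2 * dist v w" for v w
      by (rule dist_bound) (use diffG[OF clamp_in] in \<open>simp only: \<Phi> dist_norm[of "G _ _"]\<close>)
  qed (auto simp: complete_UNIV)
  then obtain v where v: "\<Phi> v = v" by auto
  have fixp: "apply_bcontfun v t = G (apply_bcontfun v) t" if "t \<in> {a..b}" for t
    using \<Phi>[of v t] clamp_cancel_cbox[of t a b] that by (simp add: v)
  define y where "y t = p + integral {a..t} (\<lambda>s. h (exp (l * (s - a)) *\<^sub>R apply_bcontfun v s) s)" for t
  have yv: "y t = exp (l * (t - a)) *\<^sub>R apply_bcontfun v t" if "t \<in> {a..b}" for t
    using fixp[OF that] by (simp add: G_def y_def flip: exp_add)
  have "(y has_vector_derivative h (y t) t) (at t within {a..b})" if "t \<in> {a..b}" for t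
  proof -
    have "((\<lambda>u. integral {a..u} (\<lambda>s. h (exp (l * (s - a)) *\<^sub>R apply_bcontfun v s) s))
        has_vector_derivative h (exp (l * (t - a)) *\<^sub>R apply_bcontfun v t) t) (at t within {a..b})"
      by (rule integral_has_vector_derivative[OF comp that]) simp
    from has_vector_derivative_add[OF has_vector_derivative_const[of p] this]
    show ?thesis
      by (simp add: yv[OF that, symmetric] y_def[abs_def, symmetric])
  qed
  moreover have "y a = p" by (simp add: y_def)
  ultimately show ?thesis by blast
qed

text \<open>Zorn's lemma for the graphs of solutions ordered by inclusion. The
  solution on the single point \<open>t0\<close> starts the construction for an arbitrary field.\<close>

lemma maximal_solution_exists:
  fixes g :: "real^'n \<Rightarrow> real \<Rightarrow> real^'n"
  shows "\<exists>J z. maximal_solution g t0 J z \<and> z t0 = p"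
proof -
  define graph where "graph J x = (\<lambda>t. (t, x t)) ` J" for J :: "real set" and x :: "real \<Rightarrow> real^'n"
  define \<A> where "\<A> = {G. \<exists>J x. solution_from g t0 J x \<and> x t0 = p \<and> G = graph J x}"
  have "solution_from g t0 {t0} (\<lambda>_. p)"
    by (auto simp: solution_from_def solution_on_def is_interval_1 has_vector_derivative_def
        has_derivative_within_singleton_iff bounded_linear_scaleR_left)
  then have "graph {t0} (\<lambda>_. p) \<in> \<A>"
    unfolding \<A>_def by blast
  then have ne: "\<A> \<noteq> {}" by blast
  have union: "\<Union>\<C> \<in> \<A>" if "\<C> \<noteq> {}" and chain: "subset.chain \<A> \<C>" for \<C>
  proof -
    have "\<forall>G\<in>\<C>. \<exists>J x. solution_from g t0 J x \<and> x t0 = p \<and> G = graph J x"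
      using chain unfolding subset.chain_def \<A>_def by auto
    then obtain JJ xx where G: "\<And>G. G \<in> \<C> \<Longrightarrow>
        solution_from g t0 (JJ G) (xx G) \<and> xx G t0 = p \<and> G = graph (JJ G) (xx G)"
      by metis
    define J where "J = \<Union> (JJ ` \<C>)"
    have mem: "(t, v) \<in> G \<longleftrightarrow> t \<in> JJ G \<and> v = xx G t" if "G \<in> \<C>" for G t v
    proof -
      have "(t, v) \<in> graph (JJ G) (xx G) \<longleftrightarrow> t \<in> JJ G \<and> v = xx G t"
        by (auto simp: graph_def)
      moreover have "G = graph (JJ G) (xx G)" using G[OF that] by blast
      ultimately show ?thesis by simp
    qed
    have agree: "xx G t = xx H t" if "G \<in> \<C>" "H \<in> \<C>" "t \<in> JJ G" "t \<in> JJ H" for G H t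
    proof -
      have "G \<subseteq> H \<or> H \<subseteq> G"
        using chain that unfolding subset_chain_def by blast
      moreover have "(t, xx G t) \<in> G" "(t, xx H t) \<in> H"
        using mem[OF that(1)] mem[OF that(2)] that(3,4) by simp_all
      ultimately have "(t, xx G t) \<in> H \<or> (t, xx H t) \<in> G" by blast
      then show ?thesis
        using mem[OF that(1), of t "xx H t"] mem[OF that(2), of t "xx G t"] by auto
    qed
    have "\<forall>t\<in>J. \<exists>G\<in>\<C>. t \<in> JJ G" by (auto simp: J_def)
    then obtain sel where sel: "\<And>t. t \<in> J \<Longrightarrow> sel t \<in> \<C> \<and> t \<in> JJ (sel t)" by metis
    define x where "x t = xx (sel t) t" for t
    have x: "x t = xx G t" if "G \<in> \<C>" "t \<in> JJ G" for G t
    proof -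
      have "t \<in> J" using that by (auto simp: J_def)
      then show ?thesis using agree sel that unfolding x_def by blast
    qed
    have int: "s \<in> JJ G" if "G \<in> \<C>" "t \<in> JJ G" "t0 \<le> s" "s \<le> t" for G s t
    proof -
      have "is_interval (JJ G)" "t0 \<in> JJ G"
        using G[OF that(1)] by (auto simp: solution_from_def)
      then show ?thesis using that unfolding is_interval_1 by blast
    qed
    have J0: "t0 \<in> J" "J \<subseteq> {t0..}"
      using G \<open>\<C> \<noteq> {}\<close> by (auto simp: J_def solution_from_def)
    have intJ: "is_interval J"
      unfolding is_interval_1
    proof (intro ballI allI impI)
      fix a b s assume "a \<in> J" "b \<in> J" "a \<le> s \<and> s \<le> b"
      moreover have "t0 \<le> a" using J0 \<open>a \<in> J\<close> by auto
      ultimately have "s \<in> JJ (sel b)" using int[of "sel b" b s] sel[of b] by auto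
      then show "s \<in> J" using sel[OF \<open>b \<in> J\<close>] by (auto simp: J_def)
    qed
    have "(x has_vector_derivative g (x t) t) (at t within J)" if t: "t \<in> J" for t
    proof -
      \<comment> \<open>One member of the chain agrees with the union on a neighbourhood of \<open>t\<close>: if \<open>t\<close> is
          not the last point, a member that reaches beyond \<open>t\<close>.\<close>
      obtain G d where Gd: "G \<in> \<C>" "t \<in> JJ G" "t < d" "J \<inter> {..<d} \<subseteq> JJ G"
      proof (cases "\<exists>t'\<in>J. t < t'")
        case True
        then obtain t' where t': "t' \<in> J" "t < t'" by blast
        have "J \<inter> {..<t'} \<subseteq> JJ (sel t')"
          using int[of "sel t'" t'] sel[OF t'(1)] J0 by auto
        then show ?thesis
          using that[of "sel t'" t'] sel[OF t'(1)] t' t by auto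
      next
        case False
        then have "J \<inter> {..<t + 1} \<subseteq> JJ (sel t)"
          using int[of "sel t" t] sel[OF t] J0 by (force simp: not_less)
        then show ?thesis
          using that[of "sel t" "t + 1"] sel[OF t] by auto
      qed
      have sub: "JJ G \<subseteq> J" using Gd by (auto simp: J_def)
      have "(xx G has_vector_derivative g (xx G t) t) (at t within JJ G)"
        using G[OF Gd(1)] Gd(2) by (auto simp: solution_from_def solution_on_def)
      then have "(x has_vector_derivative g (xx G t) t) (at t within JJ G)"
        by (rule has_vector_derivative_transform[rotated 2]) (use Gd x in auto)
      moreover have "at t within JJ G = at t within J"
        by (rule at_within_nhd[of _ "{..<d}"]) (use Gd sub in auto)
      ultimately show ?thesis using x[OF Gd(1,2)] by simp
    qed
    then have "solution_from g t0 J x"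
      using J0 intJ by (auto simp: solution_from_def solution_on_def)
    moreover have "x t0 = p"
      using G sel[OF J0(1)] x_def by auto
    moreover have "\<Union>\<C> = graph J x"
    proof (rule set_eqI)
      fix q :: "real \<times> (real^'n)"
      obtain t v where q: "q = (t, v)" by force
      have "q \<in> \<Union>\<C> \<longleftrightarrow> (\<exists>G\<in>\<C>. t \<in> JJ G \<and> v = xx G t)"
        using mem q by auto
      also have "\<dots> \<longleftrightarrow> t \<in> J \<and> v = x t"
        using x by (auto simp: J_def)
      finally show "q \<in> \<Union>\<C> \<longleftrightarrow> q \<in> graph J x"
        by (auto simp: q graph_def)
    qed
    ultimately show ?thesis unfolding \<A>_def by blast
  qed
  obtain G where "G \<in> \<A>" and Gmax: "\<And>H. H \<in> \<A> \<Longrightarrow> G \<subseteq> H \<Longrightarrow> H = G"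
    using subset_Zorn_nonempty[OF ne union] by blast
  then obtain J x where sol: "solution_from g t0 J x" "x t0 = p" and GJ: "G = graph J x"
    unfolding \<A>_def by blast
  have "\<not> (\<exists>J' y. solution_from g t0 J' y \<and> J \<subset> J' \<and> (\<forall>t\<in>J. y t = x t))"
  proof
    assume "\<exists>J' y. solution_from g t0 J' y \<and> J \<subset> J' \<and> (\<forall>t\<in>J. y t = x t)"
    then obtain J' y where y: "solution_from g t0 J' y" "J \<subset> J'" "\<forall>t\<in>J. y t = x t" by blast
    have "y t0 = p" using y sol by (auto simp: solution_from_def)
    then have "graph J' y \<in> \<A>" using y unfolding \<A>_def by blast
    moreover have "G \<subseteq> graph J' y" using y unfolding GJ graph_def by force
    ultimately have "graph J' y = graph J x" using Gmax GJ by blast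
    then have "fst ` graph J' y = fst ` graph J x" by simp
    then show False using y(2) by (simp add: graph_def image_image)
  qed
  then show ?thesis using sol unfolding maximal_solution_def by blast
qed

text \<open>A bounded solution that ends can be continued. The field is made globally Lipschitz by
  composing it with the projection onto a ball slightly larger than the bound, so that
  Picard-Lindeloef gives a solution \<open>y\<close> beyond the final time. By uniqueness \<open>y\<close> extends \<open>x\<close>, and it
  stays in the ball, where the projection does nothing, for a short time past the end of \<open>J\<close>. Using
  \<open>y\<close> from \<open>t0\<close> on treats half-open and closed \<open>J\<close> alike and requires no gluing.\<close>

lemma maximal_solution_global:
  fixes h :: "real^'n \<Rightarrow> real \<Rightarrow> real^'n"
  assumes max: "maximal_solution h t0 J x"
    and cont: "continuous_on (UNIV \<times> {t0..}) (\<lambda>(x, t). h x t)"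
    and lip: "\<And>R t1. \<exists>L. \<forall>t\<in>{t0..t1}. \<forall>x\<in>cball 0 R. \<forall>y\<in>cball 0 R.
      norm (h x t - h y t) \<le> L * norm (x - y)"
    and bdd: "\<And>t1. \<exists>R. \<forall>t\<in>J. t \<le> t1 \<longrightarrow> norm (x t) \<le> R"
  shows "J = {t0..}"
proof (rule ccontr)
  assume "J \<noteq> {t0..}"
  have J: "is_interval J" "t0 \<in> J" "J \<subseteq> {t0..}"
    and xder: "\<And>t. t \<in> J \<Longrightarrow> (x has_vector_derivative h (x t) t) (at t within J)"
    using max by (auto simp: maximal_solution_def solution_from_def solution_on_def)
  then obtain T where T: "T \<ge> t0" "T \<notin> J" using \<open>J \<noteq> {t0..}\<close> by auto
  have down: "s \<in> J" if "t \<in> J" "t0 \<le> s" "s \<le> t" for s t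
    using J that unfolding is_interval_1 by blast
  have JT: "t < T" if "t \<in> J" for t
    using down[OF that T(1)] T(2) by force
  obtain R where R: "\<And>t. t \<in> J \<Longrightarrow> norm (x t) \<le> R"
    using bdd[of T] JT by (meson less_imp_le)
  have R0: "0 \<le> R" using R[OF J(2)] norm_ge_zero order_trans by blast
  define P where "P = closest_point (cball (0::real^'n) (R + 1))"
  have ball: "convex (cball (0::real^'n) (R + 1))" "closed (cball (0::real^'n) (R + 1))"
    "cball (0::real^'n) (R + 1) \<noteq> {}"
    using R0 by auto
  have Pin: "P v \<in> cball 0 (R + 1)" for v
    unfolding P_def using ball by (intro closest_point_in_set)
  have Pid: "P v = v" if "norm v \<le> R + 1" for v
    unfolding P_def using that by (intro closest_point_self) auto
  have Plip: "norm (P v - P w) \<le> norm (v - w)" for v w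
    using closest_point_lipschitz[OF ball] by (simp add: P_def dist_norm)
  obtain L where L: "\<And>t v w. t \<in> {t0..T+1} \<Longrightarrow> v \<in> cball 0 (R+1) \<Longrightarrow> w \<in> cball 0 (R+1) \<Longrightarrow>
      norm (h v t - h w t) \<le> L * norm (v - w)"
    using lip[of "T+1" "R+1"] by blast
  have Plip': "norm (h (P v) t - h (P w) t) \<le> \<bar>L\<bar> * norm (v - w)" if "t \<in> {t0..T+1}" for v w t
  proof -
    have "norm (h (P v) t - h (P w) t) \<le> L * norm (P v - P w)"
      using L that Pin by blast
    also have "\<dots> \<le> \<bar>L\<bar> * norm (v - w)"
      by (intro mult_mono Plip) auto
    finally show ?thesis .
  qed
  have "continuous_on (UNIV \<times> {t0..T+1}) ((\<lambda>(x, t). h x t) \<circ> (\<lambda>q. (P (fst q), snd q)))"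
  proof (rule continuous_on_compose[OF _ continuous_on_subset[OF cont]])
    have "continuous_on UNIV P"
      unfolding P_def by (rule continuous_on_closest_point[OF ball])
    then show "continuous_on (UNIV \<times> {t0..T+1}) (\<lambda>q. (P (fst q), snd q))"
      by (intro continuous_on_Pair continuous_on_compose2[OF \<open>continuous_on UNIV P\<close>]
          continuous_on_fst continuous_on_snd continuous_on_id subset_UNIV)
  qed auto
  then have contP: "continuous_on (UNIV \<times> {t0..T+1}) (\<lambda>(x, t). h (P x) t)"
    by (simp add: o_def case_prod_beta)
  \<comment> \<open>The interval reaches to \<open>T + 1\<close> so that \<open>Sup J \<le> T\<close> is strictly inside it.\<close>
  obtain y where y0: "y t0 = x t0"
    and yder: "\<And>t. t \<in> {t0..T+1} \<Longrightarrow> (y has_vector_derivative h (P (y t)) t) (at t within {t0..T+1})"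
  proof -
    have "t0 \<le> T + 1" using T(1) by simp
    from picard_global[OF this contP Plip', of "x t0"] show ?thesis using that by blast
  qed
  have ycont: "continuous_on {t0..T+1} y"
    using yder by (meson continuous_on_eq_continuous_within has_vector_derivative_continuous)
  have yx: "y t = x t" if t: "t \<in> J" for t
  proof -
    have tt: "t0 \<le> t" "t < T" using J t JT by auto
    have sub: "{t0..t} \<subseteq> J" "{t0..t} \<subseteq> {t0..T+1}" using down[OF t] tt by auto
    have "(norm (y t - x t))\<^sup>2 \<le> ((norm (y t0 - x t0))\<^sup>2 + 0\<^sup>2 * (t - t0)) * exp ((2 * \<bar>L\<bar> + 1) * (t - t0))"
    proof (rule gronwall_square[where e' = "\<lambda>s. h (P (y s)) s - h (P (x s)) s"])
      fix s assume s: "s \<in> {t0..t}"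
      have "(x has_vector_derivative h (P (x s)) s) (at s within {t0..t})"
        using has_vector_derivative_within_subset[OF xder sub(1)] s sub R[of s] Pid[of "x s"]
        by force
      moreover have "(y has_vector_derivative h (P (y s)) s) (at s within {t0..t})"
        using has_vector_derivative_within_subset[OF yder sub(2)] s sub by blast
      ultimately show "((\<lambda>s. y s - x s) has_vector_derivative h (P (y s)) s - h (P (x s)) s) (at s within {t0..t})"
        by (intro has_vector_derivative_diff)
      show "norm (h (P (y s)) s - h (P (x s)) s) \<le> \<bar>L\<bar> * norm (y s - x s) + 0"
        using Plip' s sub by auto
    qed (use tt in auto)
    then show ?thesis by (simp add: y0)
  qed
  define t1 where "t1 = Sup J"
  have bddJ: "bdd_above J" using JT by (meson bdd_above.I less_imp_le)
  have t1: "t0 \<le> t1" "t1 \<le> T"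
  proof -
    show "t0 \<le> t1" unfolding t1_def by (rule cSup_upper[OF J(2) bddJ])
    show "t1 \<le> T" unfolding t1_def by (rule cSup_least) (use J(2) JT in \<open>auto intro: less_imp_le\<close>)
  qed
  have le_t1: "t \<le> t1" if "t \<in> J" for t
    unfolding t1_def using that bddJ by (rule cSup_upper)
  have lt_t1: "t \<in> J" if lt: "t0 \<le> t" "t < t1" for t
  proof -
    obtain s where "s \<in> J" "t < s"
      using less_cSupD[of J t] J(2) lt(2) unfolding t1_def by blast
    then show ?thesis using down[of s t] lt(1) by auto
  qed
  have yt1: "norm (y t1) \<le> R"
  proof -
    have "closed ({t0..T+1} \<inter> y -` cball 0 R)"
      by (rule continuous_closed_preimage[OF ycont]) auto
    moreover have "J \<subseteq> {t0..T+1} \<inter> y -` cball 0 R"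
    proof
      fix t assume t: "t \<in> J"
      then have "t0 \<le> t" using J(3) by auto
      then show "t \<in> {t0..T+1} \<inter> y -` cball 0 R"
        using JT[OF t] yx[OF t] R[OF t] by simp
    qed
    ultimately have "closure J \<subseteq> {t0..T+1} \<inter> y -` cball 0 R"
      by (intro closure_minimal)
    moreover have "t1 \<in> closure J"
      unfolding t1_def using J(2) bddJ by (intro closure_contains_Sup) auto
    ultimately show ?thesis by auto
  qed
  obtain d where d: "d > 0" "\<And>t. t \<in> {t0..T+1} \<Longrightarrow> dist t t1 < d \<Longrightarrow> dist (y t) (y t1) < 1"
  proof -
    have "t1 \<in> {t0..T+1}" using t1 by simp
    with ycont have "\<exists>d>0. \<forall>t\<in>{t0..T+1}. dist t t1 < d \<longrightarrow> dist (y t) (y t1) < 1"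
      unfolding continuous_on_iff using zero_less_one by blast
    then show ?thesis using that by blast
  qed
  define t2 where "t2 = min (T + 1) (t1 + d / 2)"
  have t2: "t1 < t2" "t2 \<le> T + 1" "t2 < t1 + d"
    using t1 d by (auto simp: t2_def)
  have ybd: "norm (y t) \<le> R + 1" if "t \<in> {t0..t2}" for t
  proof (cases "t < t1")
    case True
    then show ?thesis using lt_t1[of t] that yx[of t] R[of t] by auto
  next
    case False
    then have "dist (y t) (y t1) < 1"
      using that t2 by (intro d) (auto simp: dist_real_def)
    then show ?thesis
      using yt1 norm_triangle_sub[of "y t" "y t1"] by (simp add: dist_norm)
  qed
  have "solution_from h t0 {t0..t2} y"
    unfolding solution_from_def solution_on_def
  proof (intro conjI ballI)
    fix t assume t: "t \<in> {t0..t2}"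
    have "(y has_vector_derivative h (P (y t)) t) (at t within {t0..t2})"
      by (rule has_vector_derivative_within_subset[OF yder]) (use t t2 in auto)
    then show "(y has_vector_derivative h (y t) t) (at t within {t0..t2})"
      using Pid[OF ybd[OF t]] by simp
  qed (use t1 t2 in \<open>auto simp: is_interval_cc\<close>)
  moreover have "J \<subset> {t0..t2}"
  proof
    show "J \<subseteq> {t0..t2}" using J(3) le_t1 t2(1) by fastforce
    have "t2 \<in> {t0..t2}" "t2 \<notin> J" using t1 t2(1) le_t1[of t2] by auto
    then show "J \<noteq> {t0..t2}" by blast
  qed
  ultimately show False
    using max yx unfolding maximal_solution_def by blast
qed

section \<open>Exponential stability from the linearization\<close>

text \<open>Continuous induction: at the first time where \<open>q\<close> reaches \<open>\<rho>\<close> the bound \<open>q \<le> \<rho>\<close> holds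
  up to and including that time, so it improves to a strict one there.\<close>

lemma continuous_bootstrap:
  fixes q :: "real \<Rightarrow> real"
  assumes ab: "a \<le> b" and cont: "continuous_on {a..b} q" and start: "q a < \<rho>"
    and improve: "\<And>t. t \<in> {a..b} \<Longrightarrow> (\<And>s. s \<in> {a..t} \<Longrightarrow> q s \<le> \<rho>) \<Longrightarrow> q t < \<rho>"
    and t: "t \<in> {a..b}"
  shows "q t < \<rho>"
proof (rule ccontr)
  assume nt: "\<not> q t < \<rho>"
  define S where "S = {a..b} \<inter> q -` {\<rho>..}"
  have "closed S"
    unfolding S_def by (rule continuous_closed_preimage[OF cont]) auto
  moreover have S: "S \<noteq> {}" "bdd_below S"
    using t nt by (auto simp: S_def)
  ultimately have m: "Inf S \<in> S" by (intro closed_contains_Inf)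
  have below: "q s < \<rho>" if "a \<le> s" "s < Inf S" for s
    using cInf_lower[of s S] S that m by (force simp: S_def)
  have "q (Inf S) \<le> \<rho>"
  proof (rule ccontr)
    assume gt: "\<not> q (Inf S) \<le> \<rho>"
    have "\<exists>s\<ge>a. s \<le> Inf S \<and> q s = \<rho>"
      using m gt start by (intro IVT') (auto simp: S_def intro: continuous_on_subset[OF cont])
    then obtain s where s: "a \<le> s" "s \<le> Inf S" "q s = \<rho>" by blast
    then show False using below[of s] gt by (cases "s = Inf S") auto
  qed
  then have "q s \<le> \<rho>" if "s \<in> {a..Inf S}" for s
    using below[of s] that by (cases "s = Inf S") auto
  then have "q (Inf S) < \<rho>" using m by (intro improve) (auto simp: S_def)
  then show False using m by (auto simp: S_def)
qed

text \<open>The factor 2 pays for the incomplete last window, the factor \<open>E\<close> for the growth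
  inside it.\<close>

lemma halving_imp_exponential_decay:
  fixes q :: "real \<Rightarrow> real"
  assumes T: "0 < T" and E: "0 \<le> E" and ab: "a \<le> b" and qa: "0 \<le> q a"
    and growth: "\<And>s t. a \<le> s \<Longrightarrow> s \<le> t \<Longrightarrow> t \<le> b \<Longrightarrow> t - s \<le> T \<Longrightarrow> q t \<le> E * q s"
    and halving: "\<And>s. a \<le> s \<Longrightarrow> s + T \<le> b \<Longrightarrow> q (s + T) \<le> q s / 2"
  shows "q b \<le> 2 * E * exp (- (ln 2 / T) * (b - a)) * q a"
proof -
  have iter: "q (a + real n * T) \<le> (1/2) ^ n * q a" if "a + real n * T \<le> b" for n
    using that
  proof (induction n)
    case (Suc n)
    have le: "(a + real n * T) + T \<le> b" using Suc.prems by (simp add: algebra_simps)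
    then have "q (a + real n * T) \<le> (1/2) ^ n * q a" using T by (intro Suc.IH) auto
    moreover have "q ((a + real n * T) + T) \<le> q (a + real n * T) / 2"
      using T by (intro halving le) auto
    ultimately show ?case by (simp add: algebra_simps)
  qed auto
  define n where "n = nat \<lfloor>(b - a) / T\<rfloor>"
  have n: "real n \<le> (b - a) / T" "(b - a) / T < real n + 1"
    using ab T by (auto simp: n_def)
  then have nT: "real n * T \<le> b - a" "b - a < real n * T + T"
    using T by (auto simp: field_simps)
  have "(1/2::real) ^ n = exp (- (real n * ln 2))"
    by (simp add: exp_minus exp_of_nat_mult power_one_over inverse_eq_divide)
  also have "\<dots> \<le> exp (ln 2 + (- (ln 2 / T) * (b - a)))"
  proof -
    have "ln 2 * ((b - a) / T) \<le> ln 2 * (real n + 1)"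
      using n by (intro mult_left_mono) auto
    then show ?thesis by (simp add: algebra_simps)
  qed
  also have "\<dots> = 2 * exp (- (ln 2 / T) * (b - a))"
    by (simp only: exp_add) simp
  finally have pow: "(1/2::real) ^ n \<le> 2 * exp (- (ln 2 / T) * (b - a))" .
  have "q b \<le> E * q (a + real n * T)"
    using nT T by (intro growth) auto
  also have "\<dots> \<le> E * ((1/2) ^ n * q a)"
    using nT E by (intro mult_left_mono iter) auto
  also have "\<dots> \<le> E * (2 * exp (- (ln 2 / T) * (b - a)) * q a)"
    using E qa by (intro mult_left_mono mult_right_mono pow) auto
  finally show ?thesis by (simp add: mult_ac)
qed

text \<open>A perturbation that is small relative to the state changes a solution only by a
  proportional amount over a bounded time. Growth of \<open>z\<close> is estimated first since it controls the
  inhomogeneity in the equation for \<open>z - w\<close>.\<close>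

lemma perturbed_linear_close:
  fixes z w z' :: "real \<Rightarrow> real^'n" and D :: "real \<Rightarrow> real^'n \<Rightarrow> real^'n"
  assumes st: "s \<le> t" and b: "0 \<le> b" and \<epsilon>: "0 \<le> \<epsilon>" "\<epsilon> \<le> 1"
    and lin: "\<And>u. u \<in> {s..t} \<Longrightarrow> linear (D u)"
    and bnd: "\<And>u v. u \<in> {s..t} \<Longrightarrow> norm (D u v) \<le> b * norm v"
    and z: "\<And>u. u \<in> {s..t} \<Longrightarrow> (z has_vector_derivative z' u) (at u within {s..t})"
    and pert: "\<And>u. u \<in> {s..t} \<Longrightarrow> norm (z' u - D u (z u)) \<le> \<epsilon> * norm (z u)"
  shows perturbed_linear_growth: "norm (z t) \<le> exp ((b + 2) * (t - s)) * norm (z s)"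
    and "(\<And>u. u \<in> {s..t} \<Longrightarrow> (w has_vector_derivative D u (w u)) (at u within {s..t})) \<Longrightarrow>
      w s = z s \<Longrightarrow> norm (z t - w t) \<le> \<epsilon> * (exp ((b + 2) * (t - s)))\<^sup>2 * norm (z s)"
proof -
  have growth: "norm (z u) \<le> exp ((b + 2) * (u - s)) * norm (z s)" if u: "u \<in> {s..t}" for u
  proof -
    have sub: "{s..u} \<subseteq> {s..t}" using u by auto
    have "norm (z u) \<le> (norm (z s) + 0) * exp ((b + 1 + 1) * (u - s))"
    proof (rule gronwall[where e' = z'])
      fix v assume v: "v \<in> {s..u}"
      show "(z has_vector_derivative z' v) (at v within {s..u})"
        using v sub by (intro has_vector_derivative_within_subset[OF z sub]) auto
      have "norm (z' v) \<le> norm (D v (z v)) + norm (z' v - D v (z v))"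
        by (rule norm_triangle_sub)
      also have "\<dots> \<le> b * norm (z v) + \<epsilon> * norm (z v)"
        using v sub by (intro add_mono bnd pert) auto
      also have "\<dots> \<le> b * norm (z v) + 1 * norm (z v)"
        using \<epsilon> by (intro add_mono mult_right_mono) auto
      finally show "norm (z' v) \<le> (b + 1) * norm (z v) + 0"
        by (simp add: algebra_simps)
    qed (use u b in auto)
    then show ?thesis by (simp add: mult.commute add.assoc)
  qed
  then show "norm (z t) \<le> exp ((b + 2) * (t - s)) * norm (z s)" using st by simp
  assume w: "\<And>u. u \<in> {s..t} \<Longrightarrow> (w has_vector_derivative D u (w u)) (at u within {s..t})"
    and ws: "w s = z s"
  define E where "E = exp ((b + 2) * (t - s))"
  have "norm (z t - w t) \<le> (norm (z s - w s) + \<epsilon> * E * norm (z s)) * exp ((b + 1) * (t - s))"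
  proof (rule gronwall[where e' = "\<lambda>u. z' u - D u (w u)"])
    fix u assume u: "u \<in> {s..t}"
    show "((\<lambda>u. z u - w u) has_vector_derivative z' u - D u (w u)) (at u within {s..t})"
      by (rule has_vector_derivative_diff[OF z[OF u] w[OF u]])
    have "z' u - D u (w u) = D u (z u - w u) + (z' u - D u (z u))"
      using linear_diff[OF lin[OF u]] by simp
    then have "norm (z' u - D u (w u)) \<le> norm (D u (z u - w u)) + norm (z' u - D u (z u))"
      using norm_triangle_ineq by metis
    also have "\<dots> \<le> b * norm (z u - w u) + \<epsilon> * norm (z u)"
      by (intro add_mono bnd pert u)
    also have "\<epsilon> * norm (z u) \<le> \<epsilon> * (E * norm (z s))"
    proof (rule mult_left_mono[OF _ \<epsilon>(1)])
      have "(b + 2) * (u - s) \<le> (b + 2) * (t - s)"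
        using u b by (intro mult_left_mono) auto
      then have "exp ((b + 2) * (u - s)) * norm (z s) \<le> E * norm (z s)"
        unfolding E_def by (intro mult_right_mono iffD2[OF exp_le_cancel_iff]) auto
      then show "norm (z u) \<le> E * norm (z s)" using growth[OF u] by linarith
    qed
    finally show "norm (z' u - D u (w u)) \<le> b * norm (z u - w u) + \<epsilon> * E * norm (z s)"
      by (simp add: mult.assoc)
  qed (use st b \<epsilon> in \<open>auto simp: E_def\<close>)
  also have "\<dots> = \<epsilon> * E * norm (z s) * exp ((b + 1) * (t - s))" by (simp add: ws)
  also have "\<dots> \<le> \<epsilon> * E * norm (z s) * E"
  proof (rule mult_left_mono)
    have "(b + 1) * (t - s) \<le> (b + 2) * (t - s)"
      using st by (intro mult_right_mono) auto
    then show "exp ((b + 1) * (t - s)) \<le> E"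
      unfolding E_def by (rule iffD2[OF exp_le_cancel_iff])
  qed (use \<epsilon> in \<open>simp add: E_def\<close>)
  finally show "norm (z t - w t) \<le> \<epsilon> * (exp ((b + 2) * (t - s)))\<^sup>2 * norm (z s)"
    by (simp add: E_def power2_eq_square mult_ac)
qed

text \<open>Lyapunov's indirect method. The equation for \<open>z\<close> is only assumed while
  \<open>norm z < r\<close>, where the remainder estimate is available; that \<open>z\<close> does not leave this region is part
  of the argument. Everything is stated on compact intervals, so that the estimate is available
  before the solution is known to be global.\<close>

lemma exponential_decay_of_linearization:
  fixes D :: "real \<Rightarrow> real^'n \<Rightarrow> real^'n" and g :: "real^'n \<Rightarrow> real \<Rightarrow> real^'n"
  assumes stable: "exponentially_stable (\<lambda>z t. D t z)"
    and lin: "\<And>t. t \<ge> 0 \<Longrightarrow> linear (D t)"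
    and bnd: "\<And>t v. t \<ge> 0 \<Longrightarrow> norm (D t v) \<le> b * norm v"
    and r: "r > 0"
    and rem: "\<And>t v. t \<ge> 0 \<Longrightarrow> norm v < r \<Longrightarrow> norm (g v t - D t v) \<le> L * (norm v)\<^sup>2"
  shows "\<exists>C>0. \<exists>c>0. \<exists>\<delta>>0. \<forall>t0\<ge>0. \<forall>t1\<ge>t0. \<forall>z. continuous_on {t0..t1} z \<longrightarrow>
    (\<forall>t\<in>{t0..t1}. norm (z t) < r \<longrightarrow> (z has_vector_derivative g (z t) t) (at t within {t0..t1})) \<longrightarrow>
    norm (z t0) < \<delta> \<longrightarrow> norm (z t1) \<le> C * exp (- c * (t1 - t0)) * norm (z t0)"
proof -
  obtain C0 c0 \<delta>0 where pos: "C0 > 0" "c0 > 0" "\<delta>0 > 0"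
    and st: "\<forall>t0\<ge>0. \<forall>J z. maximal_solution (\<lambda>z t. D t z) t0 J z \<longrightarrow> norm (z t0) < \<delta>0 \<longrightarrow>
      J = {t0..} \<and> (\<forall>t\<ge>t0. norm (z t) \<le> C0 * exp (- c0 * (t - t0)) * norm (z t0))"
    using stable unfolding exponentially_stable_def by (elim exE conjE) (rule that)
  define \<beta> where "\<beta> = \<bar>b\<bar>"
  have \<beta>0: "\<beta> \<ge> 0" by (simp add: \<beta>_def)
  have \<beta>: "norm (D t v) \<le> \<beta> * norm v" if "t \<ge> 0" for t v
  proof -
    have "b * norm v \<le> \<bar>b\<bar> * norm v" by (intro mult_right_mono) auto
    then show ?thesis using bnd[OF that, of v] by (simp add: \<beta>_def)
  qed
  \<comment> \<open>After time \<open>T\<close> the linear system has contracted by a factor 4; the maximum only ensures \<open>T > 0\<close>.\<close>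
  define T where "T = max 1 (ln (4 * C0) / c0)"
  have T: "T > 0" by (simp add: T_def)
  have quarter: "C0 * exp (- c0 * T) \<le> 1/4"
  proof -
    have "ln (4 * C0) \<le> c0 * T"
      using pos by (simp add: T_def field_simps max_def)
    then have "exp (ln (4 * C0)) \<le> exp (c0 * T)" by (simp only: exp_le_cancel_iff)
    then show ?thesis using pos by (simp add: exp_minus field_simps)
  qed
  define E where "E = exp ((\<beta> + 2) * T)"
  have E: "E \<ge> 1" using T by (simp add: E_def \<beta>_def)
  \<comment> \<open>\<open>E\<close> bounds the growth on one window; with this \<open>\<epsilon>\<close> the deviation from the linear solution,
      at most \<open>\<epsilon> * E\<^sup>2\<close> times the initial error, contributes another quarter.\<close>
  define \<epsilon> where "\<epsilon> = 1 / (4 * E\<^sup>2)"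
  have \<epsilon>: "\<epsilon> > 0" "\<epsilon> \<le> 1" "\<epsilon> * E\<^sup>2 = 1/4"
  proof -
    have "1 \<le> E\<^sup>2" "0 < 4 * E\<^sup>2" using one_le_power[OF E, of 2] E by auto
    then show "\<epsilon> > 0" "\<epsilon> \<le> 1" "\<epsilon> * E\<^sup>2 = 1/4"
      by (auto simp: \<epsilon>_def field_simps)
  qed
  \<comment> \<open>Below \<open>\<rho>\<close> the quadratic remainder is dominated by \<open>\<epsilon> * norm v\<close> and the stability hypothesis
      applies to the comparison solution.\<close>
  define \<rho> where "\<rho> = min (min (r / 2) (\<delta>0 / 2)) (\<epsilon> / (\<bar>L\<bar> + 1))"
  have \<rho>: "\<rho> > 0" "\<rho> < r" "\<rho> < \<delta>0" "\<bar>L\<bar> * \<rho> \<le> \<epsilon>"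
  proof -
    show "\<rho> > 0" "\<rho> < r" "\<rho> < \<delta>0"
      using r pos \<epsilon> by (auto simp: \<rho>_def)
    then have "\<bar>L\<bar> * \<rho> \<le> (\<bar>L\<bar> + 1) * \<rho>" by simp
    also have "\<dots> \<le> (\<bar>L\<bar> + 1) * (\<epsilon> / (\<bar>L\<bar> + 1))"
      by (intro mult_left_mono) (auto simp: \<rho>_def)
    also have "\<dots> = \<epsilon>" by simp
    finally show "\<bar>L\<bar> * \<rho> \<le> \<epsilon>" .
  qed
  \<comment> \<open>The decay estimate has the constant \<open>2 * E\<close>, so starting below \<open>\<delta>\<close> keeps \<open>z\<close> below \<open>\<rho>\<close>.\<close>
  define \<delta> where "\<delta> = \<rho> / (2 * E)"
  have \<delta>: "\<delta> > 0" "\<delta> \<le> \<rho>" "2 * E * \<delta> = \<rho>"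
    using E \<rho> by (auto simp: \<delta>_def field_simps)
  have rem': "norm (g v t - D t v) \<le> \<epsilon> * norm v" if "t \<ge> 0" "norm v \<le> \<rho>" for t v
  proof -
    have "norm (g v t - D t v) \<le> L * (norm v)\<^sup>2"
      using that \<rho> by (intro rem) auto
    also have "\<dots> \<le> \<bar>L\<bar> * (\<rho> * norm v)"
      unfolding power2_eq_square using that \<rho> by (intro mult_mono) auto
    also have "\<dots> \<le> \<epsilon> * norm v"
      using mult_right_mono[OF \<rho>(4), of "norm v"] by (simp add: mult.assoc)
    finally show ?thesis .
  qed
  have main: "norm (z t2) \<le> 2 * E * exp (- (ln 2 / T) * (t2 - t0)) * norm (z t0)"
    if t0: "0 \<le> t0" "t0 \<le> t2"
      and zder: "\<And>t. t \<in> {t0..t2} \<Longrightarrow> (z has_vector_derivative g (z t) t) (at t within {t0..t2})"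
      and small: "\<And>t. t \<in> {t0..t2} \<Longrightarrow> norm (z t) \<le> \<rho>"
    for t0 t2 z
  proof (rule halving_imp_exponential_decay[where q = "\<lambda>t. norm (z t)"])
    have zsub: "(z has_vector_derivative g (z u) u) (at u within {s..t})"
      if "t0 \<le> s" "t \<le> t2" "u \<in> {s..t}" for s t u
      using that by (intro has_vector_derivative_within_subset[OF zder]) auto
    fix s assume s: "t0 \<le> s"
    { fix t assume t: "s \<le> t" "t \<le> t2" "t - s \<le> T"
      have "norm (z t) \<le> exp ((\<beta> + 2) * (t - s)) * norm (z s)"
        by (rule perturbed_linear_growth[where \<epsilon> = \<epsilon> and D = D and z' = "\<lambda>u. g (z u) u"])
           (use s t t0 \<epsilon> \<beta>0 in \<open>auto intro!: \<beta> lin zsub rem' small\<close>)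
      also have "\<dots> \<le> E * norm (z s)"
      proof (rule mult_right_mono)
        have "(\<beta> + 2) * (t - s) \<le> (\<beta> + 2) * T"
          using t by (intro mult_left_mono) (auto simp: \<beta>_def)
        then show "exp ((\<beta> + 2) * (t - s)) \<le> E"
          unfolding E_def by (rule iffD2[OF exp_le_cancel_iff])
      qed simp
      finally show "norm (z t) \<le> E * norm (z s)" . }
    assume sT: "s + T \<le> t2"
    \<comment> \<open>The linear solution through \<open>z s\<close>; its domain is all of \<open>{s..}\<close> by the stability hypothesis.\<close>
    obtain J w where w: "maximal_solution (\<lambda>z t. D t z) s J w" "w s = z s"
      using maximal_solution_exists by blast
    have "norm (w s) < \<delta>0" using small[of s] s sT T \<rho> w by auto
    then have J: "J = {s..}" and wbd: "norm (w t) \<le> C0 * exp (- c0 * (t - s)) * norm (w s)" if "t \<ge> s" for t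
      using st[rule_format, OF _ w(1)] s t0 that by auto
    have wder: "(w has_vector_derivative D u (w u)) (at u within {s..s+T})" if "u \<in> {s..s+T}" for u
    proof -
      have "(w has_vector_derivative D u (w u)) (at u within J)"
        using w(1) that J[of s] by (auto simp: maximal_solution_def solution_from_def solution_on_def)
      then show ?thesis
        by (rule has_vector_derivative_within_subset) (use J[of s] in auto)
    qed
    have "norm (z (s+T) - w (s+T)) \<le> \<epsilon> * (exp ((\<beta> + 2) * (s + T - s)))\<^sup>2 * norm (z s)"
      by (rule perturbed_linear_close[where D = D and z' = "\<lambda>u. g (z u) u"])
         (use s sT T t0 \<epsilon> \<beta>0 w(2) in \<open>auto intro!: \<beta> lin zsub rem' small wder\<close>)
    also have "\<dots> = 1/4 * norm (z s)"
      using \<epsilon>(3) by (simp add: E_def)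
    finally have "norm (z (s+T) - w (s+T)) \<le> 1/4 * norm (z s)" .
    moreover have "norm (w (s+T)) \<le> 1/4 * norm (z s)"
    proof -
      have "norm (w (s+T)) \<le> C0 * exp (- c0 * T) * norm (z s)"
        using wbd[of "s+T"] T w(2) by simp
      also have "\<dots> \<le> 1/4 * norm (z s)" by (intro mult_right_mono quarter) auto
      finally show ?thesis .
    qed
    ultimately show "norm (z (s + T)) \<le> norm (z s) / 2"
      using norm_triangle_sub[of "z (s+T)" "w (s+T)"] by linarith
  qed (use T E t0 in auto)
  have "norm (z t1) \<le> 2 * E * exp (- (ln 2 / T) * (t1 - t0)) * norm (z t0)"
    if t0: "t0 \<ge> 0" "t1 \<ge> t0" and zc: "continuous_on {t0..t1} z"
      and zder: "\<And>t. t \<in> {t0..t1} \<Longrightarrow> norm (z t) < r \<Longrightarrow>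
        (z has_vector_derivative g (z t) t) (at t within {t0..t1})"
      and start: "norm (z t0) < \<delta>" for t0 t1 z
  proof -
    have while_small: "norm (z t) \<le> 2 * E * exp (- (ln 2 / T) * (t - t0)) * norm (z t0)"
      if t: "t \<in> {t0..t1}" and small: "\<And>s. s \<in> {t0..t} \<Longrightarrow> norm (z s) \<le> \<rho>" for t
    proof (rule main)
      fix s assume s: "s \<in> {t0..t}"
      show "(z has_vector_derivative g (z s) s) (at s within {t0..t})"
        by (rule has_vector_derivative_within_subset[OF zder]) (use s t small[OF s] \<rho> in auto)
    qed (use t t0 small in auto)
    have "norm (z t) < \<rho>" if t: "t \<in> {t0..t1}" for t
    proof (rule continuous_bootstrap[OF t0(2) _ _ _ t, where q = "\<lambda>t. norm (z t)"])
      show "norm (z t) < \<rho>" if t: "t \<in> {t0..t1}" and small: "\<And>s. s \<in> {t0..t} \<Longrightarrow> norm (z s) \<le> \<rho>" for t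
      proof -
        have "2 * E * exp (- (ln 2 / T) * (t - t0)) * norm (z t0) \<le> 2 * E * 1 * norm (z t0)"
          using t T E by (intro mult_right_mono mult_left_mono) (auto simp: mult_nonpos_nonneg)
        also have "\<dots> < 2 * E * \<delta>" using start E by simp
        finally show ?thesis using while_small[OF t small] \<delta> by simp
      qed
    qed (use zc start \<delta> in \<open>auto intro: continuous_intros\<close>)
    then show ?thesis using t0 by (intro while_small) (auto intro: less_imp_le)
  qed
  then show ?thesis
    using E T \<delta>(1) by (intro exI[of _ "2 * E"] exI[of _ "ln 2 / T"] exI[of _ \<delta>] conjI) auto
qed

section \<open>Smooth maps and gradients\<close>

lemma smooth_on_imp_differentiable:
  assumes "smooth_on UNIV F" shows "F differentiable (at x)"
proof -
  have "Ck_on (Suc 0) UNIV F" using assms unfolding smooth_on_def by blast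
  then show ?thesis by (simp add: differentiable_on_def)
qed

lemma smooth_on_imp_continuous_on: "smooth_on S F \<Longrightarrow> continuous_on S F"
  unfolding smooth_on_def by (metis Ck_on.simps(1))

text \<open>The partial derivatives are bounded on the compact ball and dominate the operator
  norm of the derivative; the mean value inequality on the convex ball concludes.\<close>

lemma smooth_on_imp_lipschitz_cball:
  fixes F :: "'a::euclidean_space \<Rightarrow> 'b::real_normed_vector"
  assumes F: "smooth_on UNIV F"
  obtains L where "L \<ge> 0" "\<And>x y. norm x \<le> R \<Longrightarrow> norm y \<le> R \<Longrightarrow> norm (F x - F y) \<le> L * norm (x - y)"
proof -
  let ?F' = "\<lambda>x. frechet_derivative F (at x)"
  have der: "(F has_derivative ?F' x) (at x)" for x
    using smooth_on_imp_differentiable[OF F] frechet_derivative_works by blast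
  have "Ck_on (Suc 0) UNIV F" using F unfolding smooth_on_def by blast
  then have cont: "continuous_on (cball 0 R) (\<lambda>x. \<Sum>i\<in>Basis. norm (?F' x i))"
    by (intro continuous_intros) (auto intro: continuous_on_subset)
  have "bounded ((\<lambda>x. \<Sum>i\<in>Basis. norm (?F' x i)) ` cball 0 R)"
    by (intro compact_imp_bounded compact_continuous_image cont) simp
  then obtain L where L: "\<And>x. x \<in> cball 0 R \<Longrightarrow> norm (\<Sum>i\<in>Basis. norm (?F' x i)) \<le> L"
    unfolding bounded_iff by blast
  have "norm (F x - F y) \<le> \<bar>L\<bar> * norm (x - y)" if "norm x \<le> R" "norm y \<le> R" for x y
  proof (rule differentiable_bound[where S = "cball 0 R" and f' = ?F'])
    fix z assume z: "z \<in> cball (0::'a) R"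
    show "(F has_derivative ?F' z) (at z within cball 0 R)"
      using der has_derivative_at_withinI by blast
    have "onorm (?F' z) \<le> (\<Sum>i\<in>Basis. norm (?F' z i))"
      using der by (intro onorm_componentwise has_derivative_bounded_linear)
    then show "onorm (?F' z) \<le> \<bar>L\<bar>" using L[OF z] unfolding real_norm_def by linarith
  qed (use that in auto)
  then show ?thesis using that[of "\<bar>L\<bar>"] by auto
qed

lemma grad_differentiable:
  fixes V :: "real^'n \<Rightarrow> real"
  assumes "smooth_on UNIV V" shows "grad V differentiable (at x)"
proof -
  have "Ck_on (Suc (Suc 0)) UNIV V" using assms unfolding smooth_on_def by blast
  then have "(\<lambda>x. frechet_derivative V (at x) (axis i 1)) differentiable (at x)" for i
    by (simp add: differentiable_on_def)
  then have "(\<lambda>x. \<Sum>i\<in>UNIV. frechet_derivative V (at x) (axis i 1) *\<^sub>R (axis i 1 :: real^'n)) differentiable (at x)"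
    by (intro differentiable_sum differentiable_scaleR) auto
  moreover have "grad V = (\<lambda>x. \<Sum>i\<in>UNIV. frechet_derivative V (at x) (axis i 1) *\<^sub>R axis i 1)"
    unfolding grad_def using basis_expansion[of "\<chi> i. frechet_derivative V (at _) (axis i 1)", symmetric]
    by (simp add: scalar_mult_eq_scaleR)
  ultimately show ?thesis by simp
qed

lemma grad_eq_0_at_minimum:
  fixes V :: "real^'n \<Rightarrow> real"
  assumes "V differentiable (at x)" and "\<And>y. V x \<le> V y"
  shows "grad V x = 0"
proof -
  have "frechet_derivative V (at x) = (\<lambda>v. 0)"
    by (rule differential_zero_maxmin[of x UNIV V]) (use assms frechet_derivative_works in auto)
  then show ?thesis by (simp add: grad_def vec_eq_iff)
qed

lemma norm_matrix_vector_mult_le: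
  fixes A :: "real^'n^'m"
  shows "norm (A *v x) \<le> norm A * norm x"
proof -
  have "norm (A *v x) \<le> L2_set (\<lambda>i. norm (A $ i) * norm x) UNIV"
    unfolding norm_vec_def[of "A *v x"] matrix_vector_mul_component
    by (rule L2_set_mono) (auto simp: Cauchy_Schwarz_ineq2)
  also have "\<dots> = norm A * norm x"
    by (simp add: norm_vec_def[of A] L2_set_left_distrib)
  finally show ?thesis .
qed

lemma continuous_on_matrix_vector_mult:
  fixes K :: "'a::topological_space \<Rightarrow> real^'n^'m"
  assumes "continuous_on S K" "continuous_on S z"
  shows "continuous_on S (\<lambda>t. K t *v z t)"
  unfolding matrix_vector_mult_def
  by (intro continuous_on_vec_lambda continuous_on_sum continuous_on_mult continuous_on_component assms)

section \<open>The closed loop\<close>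

text \<open>Chain rule for the substitution \<open>u = q - K *v z\<close>. Joint differentiability of \<open>F\<close> is
  what allows the derivative to be split into the two partial Jacobians.\<close>

lemma closed_loop_linearization:
  fixes F :: "(real^'n) \<times> (real^'k) \<Rightarrow> real^'n" and K :: "real^'n^'k"
  assumes F: "F differentiable (at (p, q))"
  shows "((\<lambda>z. F (p + z, q - K *v z)) has_derivative
    (\<lambda>v. jacobian (\<lambda>x. F (x, q)) (at p) *v v + jacobian (\<lambda>u. F (p, u)) (at q) *v (- (K *v v)))) (at 0)"
proof -
  define F' where "F' = frechet_derivative F (at (p, q))"
  have F': "(F has_derivative F') (at (p, q))"
    using F unfolding F'_def frechet_derivative_works .
  interpret F': bounded_linear F' by (rule has_derivative_bounded_linear[OF F'])
  have A: "((\<lambda>x. F (x, q)) has_derivative (\<lambda>h. F' (h, 0))) (at p)"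
    by (rule has_derivative_compose[where f = "\<lambda>x. (x, q)", OF _ F'])
       (auto intro!: derivative_eq_intros)
  have B: "((\<lambda>u. F (p, u)) has_derivative (\<lambda>h. F' (0, h))) (at q)"
    by (rule has_derivative_compose[where f = "\<lambda>u. (p, u)", OF _ F'])
       (auto intro!: derivative_eq_intros)
  have jA: "jacobian (\<lambda>x. F (x, q)) (at p) *v h = F' (h, 0)" for h
    using has_derivative_unique[OF A] A jacobian_works differentiableI by metis
  have jB: "jacobian (\<lambda>u. F (p, u)) (at q) *v h = F' (0, h)" for h
    using has_derivative_unique[OF B] B jacobian_works differentiableI by metis
  have "((\<lambda>z. K *v z) has_derivative (\<lambda>z. K *v z)) (at 0)"
    by (intro bounded_linear_imp_has_derivative matrix_vector_mul_bounded_linear)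
  then have inner: "((\<lambda>z. (p + z, q - K *v z)) has_derivative (\<lambda>v. (v, - (K *v v)))) (at 0)"
    by (auto intro!: derivative_eq_intros)
  have "((\<lambda>z. F (p + z, q - K *v z)) has_derivative (\<lambda>v. F' (v, - (K *v v)))) (at 0)"
    by (rule has_derivative_compose[where f = "\<lambda>z. (p + z, q - K *v z)", OF inner]) (use F' in simp)
  moreover have "F' (v, - (K *v v)) = F' (v, 0) + F' (0, - (K *v v))" for v
    using F'.add[of "(v, 0)" "(0, - (K *v v))"] by simp
  ultimately show ?thesis by (simp only: jA jB)
qed

text \<open>Mean value inequality for \<open>\<phi>\<close> minus its linear part on the ball of radius
  \<open>norm v\<close>, where the derivative of the difference is at most \<open>L * norm v\<close>.\<close>

lemma jacobian_lipschitz_remainder: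
  fixes \<phi> :: "real^'n \<Rightarrow> real^'m"
  assumes diff: "\<And>w. norm w < r \<Longrightarrow> \<phi> differentiable (at w)"
    and lip: "L-lipschitz_on (ball 0 r) (\<lambda>w. jacobian \<phi> (at w))"
    and v: "norm v < r"
  shows "norm (\<phi> v - \<phi> 0 - jacobian \<phi> (at 0) *v v) \<le> L * (norm v)\<^sup>2"
proof -
  let ?J = "\<lambda>w. jacobian \<phi> (at w)"
  have r: "r > 0" using v norm_ge_zero[of v] by linarith
  have "norm ((\<phi> v - ?J 0 *v v) - (\<phi> 0 - ?J 0 *v 0)) \<le> (L * norm v) * norm (v - 0)"
  proof (rule differentiable_bound[where S = "cball 0 (norm v)" and f' = "\<lambda>w h. ?J w *v h - ?J 0 *v h"])
    fix w :: "real^'n" assume w: "w \<in> cball 0 (norm v)"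
    then have wr: "norm w < r" using v by simp
    have "(\<phi> has_derivative (\<lambda>h. ?J w *v h)) (at w)"
      using diff[OF wr] jacobian_works by blast
    then have "((\<lambda>w. \<phi> w - ?J 0 *v w) has_derivative (\<lambda>h. ?J w *v h - ?J 0 *v h)) (at w)"
      by (intro has_derivative_diff bounded_linear_imp_has_derivative matrix_vector_mul_bounded_linear)
    then show "((\<lambda>w. \<phi> w - ?J 0 *v w) has_derivative (\<lambda>h. ?J w *v h - ?J 0 *v h)) (at w within cball 0 (norm v))"
      by (rule has_derivative_at_withinI)
    have "norm (?J w - ?J 0) \<le> L * norm w"
      using lipschitz_onD[OF lip, of w 0] wr r by (simp add: dist_norm)
    also have "\<dots> \<le> L * norm v"
      using w lipschitz_on_nonneg[OF lip] by (intro mult_left_mono) auto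
    finally have J: "norm (?J w - ?J 0) \<le> L * norm v" .
    show "onorm (\<lambda>h. ?J w *v h - ?J 0 *v h) \<le> L * norm v"
    proof (rule onorm_le)
      fix h
      have "norm (?J w *v h - ?J 0 *v h) \<le> norm (?J w - ?J 0) * norm h"
        using norm_matrix_vector_mult_le[of "?J w - ?J 0" h] by (simp add: matrix_vector_mult_diff_rdistrib)
      also have "\<dots> \<le> L * norm v * norm h" by (intro mult_right_mono J) auto
      finally show "norm (?J w *v h - ?J 0 *v h) \<le> L * norm v * norm h" .
    qed
  qed auto
  then show ?thesis by (simp add: power2_eq_square algebra_simps)
qed

lemma closed_loop_continuous:
  fixes X :: "real^'n \<Rightarrow> real^'k \<Rightarrow> real^'n" and K :: "real \<Rightarrow> real^'n^'k"
  assumes X: "continuous_on UNIV (\<lambda>(x, u). X x u)"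
    and x0: "continuous_on S x0" and u0: "continuous_on S u0" and K: "continuous_on S K"
  shows "continuous_on (UNIV \<times> S) (\<lambda>(z, t). X z (u0 t - K t *v (z - x0 t)))"
proof -
  have snd: "continuous_on (UNIV \<times> S) (\<lambda>q. c (snd q))" if "continuous_on S c"
    for c :: "real \<Rightarrow> 'c::topological_space"
    by (rule continuous_on_compose2[OF that continuous_on_snd[OF continuous_on_id]]) auto
  have "continuous_on (UNIV \<times> S) (\<lambda>q. (fst q, u0 (snd q) - K (snd q) *v (fst q - x0 (snd q))))"
    by (intro continuous_on_Pair continuous_on_diff continuous_on_matrix_vector_mult
        continuous_on_fst continuous_on_id snd x0 u0 K)
  from continuous_on_compose2[OF X this subset_UNIV] show ?thesis
    by (simp add: case_prod_beta)
qed

text \<open>For bounded \<open>t\<close> and \<open>z\<close> the feedback values are bounded too, so a Lipschitz constant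
  of \<open>X\<close> on one large ball serves all times in the interval.\<close>

lemma closed_loop_locally_lipschitz:
  fixes X :: "real^'n \<Rightarrow> real^'k \<Rightarrow> real^'n" and K :: "real \<Rightarrow> real^'n^'k"
  assumes X: "smooth_on UNIV (\<lambda>(x, u). X x u)"
    and x0: "continuous_on {a..} x0" and u0: "continuous_on {a..} u0" and K: "continuous_on {a..} K"
  shows "\<exists>L. \<forall>t\<in>{a..b}. \<forall>x\<in>cball 0 R. \<forall>y\<in>cball 0 R.
    norm (X x (u0 t - K t *v (x - x0 t)) - X y (u0 t - K t *v (y - x0 t))) \<le> L * norm (x - y)"
proof -
  have bdd: "\<exists>B. \<forall>t\<in>{a..b}. norm (c t) \<le> B" if "continuous_on {a..} c"
    for c :: "real \<Rightarrow> 'c::real_normed_vector"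
  proof -
    have "bounded (c ` {a..b})"
      by (intro compact_imp_bounded compact_continuous_image continuous_on_subset[OF that]) auto
    then show ?thesis unfolding bounded_iff by blast
  qed
  obtain k0 k1 k2 where k: "\<And>t. t \<in> {a..b} \<Longrightarrow> norm (x0 t) \<le> k0"
    "\<And>t. t \<in> {a..b} \<Longrightarrow> norm (u0 t) \<le> k1" "\<And>t. t \<in> {a..b} \<Longrightarrow> norm (K t) \<le> k2"
    using bdd[OF x0] bdd[OF u0] bdd[OF K] by blast
  define Q where "Q = R + (k1 + k2 * (R + k0))"
  obtain L where L: "L \<ge> 0" "\<And>p q. norm p \<le> Q \<Longrightarrow> norm q \<le> Q \<Longrightarrow>
      norm ((\<lambda>(x, u). X x u) p - (\<lambda>(x, u). X x u) q) \<le> L * norm (p - q)"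
    using smooth_on_imp_lipschitz_cball[OF X] by blast
  have "norm (X x (u0 t - K t *v (x - x0 t)) - X y (u0 t - K t *v (y - x0 t))) \<le> L * (1 + k2) * norm (x - y)"
    if t: "t \<in> {a..b}" and xy: "x \<in> cball 0 R" "y \<in> cball 0 R" for t x y
  proof -
    let ?p = "\<lambda>x. (x, u0 t - K t *v (x - x0 t))"
    have Kv: "norm (K t *v v) \<le> k2 * norm v" for v
    proof -
      have "norm (K t) * norm v \<le> k2 * norm v" by (intro mult_right_mono k t) auto
      then show ?thesis using norm_matrix_vector_mult_le[of "K t" v] by linarith
    qed
    have k2: "0 \<le> k2" using k(3)[OF t] norm_ge_zero order_trans by blast
    have p: "norm (?p x) \<le> Q" if "x \<in> cball 0 R" for x
    proof -
      have "norm (x - x0 t) \<le> R + k0"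
        using that k(1)[OF t] norm_triangle_ineq4[of x "x0 t"] by simp
      then have "norm (K t *v (x - x0 t)) \<le> k2 * (R + k0)"
        using Kv[of "x - x0 t"] mult_left_mono[OF _ k2] by (meson order_trans)
      then have "norm (u0 t - K t *v (x - x0 t)) \<le> k1 + k2 * (R + k0)"
        using k(2)[OF t] norm_triangle_ineq4[of "u0 t" "K t *v (x - x0 t)"] by linarith
      then show ?thesis
        using that norm_Pair_le[of x "u0 t - K t *v (x - x0 t)"] by (simp add: Q_def)
    qed
    have "norm (X x (u0 t - K t *v (x - x0 t)) - X y (u0 t - K t *v (y - x0 t))) \<le> L * norm (?p x - ?p y)"
      using L(2)[OF p[OF xy(1)] p[OF xy(2)]] by simp
    also have "?p x - ?p y = (x - y, - (K t *v (x - y)))"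
      by (simp add: matrix_vector_mult_diff_distrib)
    also have "L * norm (x - y, - (K t *v (x - y))) \<le> L * ((1 + k2) * norm (x - y))"
    proof (intro mult_left_mono L(1))
      have "norm (x - y, - (K t *v (x - y))) \<le> norm (x - y) + norm (K t *v (x - y))"
        using norm_Pair_le[of "x - y" "- (K t *v (x - y))"] by (simp only: norm_minus_cancel)
      also have "\<dots> \<le> norm (x - y) + k2 * norm (x - y)"
        by (intro add_left_mono Kv)
      finally show "norm (x - y, - (K t *v (x - y))) \<le> (1 + k2) * norm (x - y)"
        by (simp only: distrib_right mult_1_left)
    qed
    finally show ?thesis by (simp add: mult.assoc)
  qed
  then show ?thesis by blast
qed

section \<open>Tracking on the invariant manifold\<close>

theorem mainTheorem5:
  fixes X Xt :: "real^'n \<Rightarrow> real^'k \<Rightarrow> real^'n"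
    and M :: "(real^'n) set"
    and V :: "real^'n \<Rightarrow> real"
    and x0 :: "real \<Rightarrow> real^'n"
    and u0 :: "real \<Rightarrow> real^'k"
    and K :: "real \<Rightarrow> real^'n^'k"
    and A :: "real \<Rightarrow> real^'n^'n"
    and B :: "real \<Rightarrow> real^'k^'n"
    and r :: real
    and f :: "real^'n \<Rightarrow> real \<Rightarrow> real^'n"
  assumes X_smooth: "smooth_on UNIV (\<lambda>(x, u). X x u)"
    and M_submanifold: "embedded_submanifold M"
    and M_invariant: "control_invariant X M"
    and V_smooth: "smooth_on UNIV V"
    and V_nonneg: "\<And>x. V x \<ge> 0"
    and M_zero_set: "M = V -` {0}"
    and Xt_eq: "\<And>x u. Xt x u = X x u - grad V x"
    and x0_smooth: "smooth_on {0..} x0"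
    and x0_in_M: "\<And>t. t \<ge> 0 \<Longrightarrow> x0 t \<in> M"
    and u0_smooth: "smooth_on {0..} u0"
    and x0_solution: "solution_on (\<lambda>x t. Xt x (u0 t)) {0..} x0"
    and K_smooth: "smooth_on {0..} K"
    and A_eq: "\<And>t. t \<ge> 0 \<Longrightarrow> A t = jacobian (\<lambda>x. Xt x (u0 t)) (at (x0 t))"
    and B_eq: "\<And>t. t \<ge> 0 \<Longrightarrow> B t = jacobian (\<lambda>u. Xt (x0 t) u) (at (u0 t))"
    and linear_stable:
      "exponentially_stable (\<lambda>z t. A t *v z + B t *v (- (K t *v z)))"
    and r_pos: "r > 0"
    and f_eq: "\<And>z t. z \<in> ball 0 r \<Longrightarrow> t \<ge> 0 \<Longrightarrow>
      f z t = Xt (x0 t + z) (u0 t - K t *v z) - Xt (x0 t) (u0 t)"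
    and f_deriv_bounded:
      "\<exists>b. \<forall>t\<ge>0. \<forall>z\<in>ball 0 r. norm (jacobian (\<lambda>w. f w t) (at z)) \<le> b"
    and f_deriv_lipschitz:
      "\<exists>L. \<forall>t\<ge>0. L-lipschitz_on (ball 0 r) (\<lambda>z. jacobian (\<lambda>w. f w t) (at z))"
  shows "exponentially_tracks_on M X (\<lambda>x t. u0 t - K t *v (x - x0 t)) x0"
proof -
  define F where "F = (\<lambda>q. Xt (fst q) (snd q))"
  have F_diff: "F differentiable (at q)" for q
  proof -
    have X': "(\<lambda>q. X (fst q) (snd q)) differentiable (at q)"
      using smooth_on_imp_differentiable[OF X_smooth, of q] by (simp add: case_prod_unfold)
    have "(\<lambda>q. grad V (fst q)) differentiable (at q)"
      using differentiable_chain_at[OF bounded_linear_imp_differentiable[OF bounded_linear_fst]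
          grad_differentiable[OF V_smooth], of q]
      by (simp add: o_def)
    from differentiable_diff[OF X' this] show ?thesis
      by (simp add: F_def Xt_eq)
  qed
  have grad0: "grad V x = 0" if "x \<in> M" for x
    using that M_zero_set V_nonneg
    by (intro grad_eq_0_at_minimum smooth_on_imp_differentiable[OF V_smooth]) auto
  have x0_cont: "continuous_on {0..} x0" and u0_cont: "continuous_on {0..} u0"
    and K_cont: "continuous_on {0..} K"
    using x0_smooth u0_smooth K_smooth by (auto intro: smooth_on_imp_continuous_on)

  define D where "D t v = A t *v v + B t *v (- (K t *v v))" for t v
  let ?J = "\<lambda>t z. jacobian (\<lambda>w. f w t) (at z)"
  have f_F: "f z t = F (x0 t + z, u0 t - K t *v z) - F (x0 t, u0 t)" if "norm z < r" "t \<ge> 0" for z t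
    using f_eq[of z t] that by (simp add: F_def)
  have f_diff: "(\<lambda>w. f w t) differentiable (at z)" if "norm z < r" "t \<ge> 0" for z t
  proof -
    have "((\<lambda>w. K t *v w) has_derivative (\<lambda>w. K t *v w)) (at z)"
      by (intro bounded_linear_imp_has_derivative matrix_vector_mul_bounded_linear)
    then have "((\<lambda>w. (x0 t + w, u0 t - K t *v w)) has_derivative (\<lambda>v. (v, - (K t *v v)))) (at z)"
      by (auto intro!: derivative_eq_intros)
    from differentiable_chain_at[OF differentiableI[OF this] F_diff]
    have "(\<lambda>w. F (x0 t + w, u0 t - K t *v w) - F (x0 t, u0 t)) differentiable (at z)"
      by (intro differentiable_diff) (auto simp: o_def)
    then obtain f' where "((\<lambda>w. F (x0 t + w, u0 t - K t *v w) - F (x0 t, u0 t)) has_derivative f') (at z)"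
      unfolding differentiable_def by blast
    then have "((\<lambda>w. f w t) has_derivative f') (at z)"
      by (rule has_derivative_transform_within_open[where s = "ball 0 r"]) (use that f_F in auto)
    then show ?thesis by (rule differentiableI)
  qed
  have D_J: "D t v = ?J t 0 *v v" if t: "t \<ge> 0" for t v
  proof -
    have "((\<lambda>w. f w t) has_derivative (\<lambda>v. ?J t 0 *v v)) (at 0)"
      using f_diff[of 0 t] t r_pos jacobian_works by auto
    moreover have "((\<lambda>w. f w t) has_derivative D t) (at 0)"
    proof (rule has_derivative_transform_within_open[where s = "ball 0 r"])
      have "((\<lambda>w. F (x0 t + w, u0 t - K t *v w)) has_derivative D t) (at 0)"
        using closed_loop_linearization[OF F_diff, of "x0 t" "u0 t" "K t"]
        by (simp add: D_def[abs_def] A_eq[OF t] B_eq[OF t] F_def)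
      from has_derivative_diff[OF this has_derivative_const[of "F (x0 t, u0 t)"]]
      show "((\<lambda>w. F (x0 t + w, u0 t - K t *v w) - F (x0 t, u0 t)) has_derivative D t) (at 0)"
        by simp
    qed (use r_pos t f_F in auto)
    ultimately show ?thesis
      using has_derivative_unique by metis
  qed
  obtain b where b: "\<And>t z. t \<ge> 0 \<Longrightarrow> z \<in> ball 0 r \<Longrightarrow> norm (?J t z) \<le> b"
    using f_deriv_bounded by blast
  obtain L where L: "\<And>t. t \<ge> 0 \<Longrightarrow> L-lipschitz_on (ball 0 r) (?J t)"
    using f_deriv_lipschitz by blast
  have decay: "\<exists>C>0. \<exists>c>0. \<exists>\<delta>>0. \<forall>t0\<ge>0. \<forall>t1\<ge>t0. \<forall>z. continuous_on {t0..t1} z \<longrightarrow>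
    (\<forall>t\<in>{t0..t1}. norm (z t) < r \<longrightarrow> (z has_vector_derivative f (z t) t) (at t within {t0..t1})) \<longrightarrow>
    norm (z t0) < \<delta> \<longrightarrow> norm (z t1) \<le> C * exp (- c * (t1 - t0)) * norm (z t0)"
  proof (rule exponential_decay_of_linearization[where D = D and b = b and L = L])
    show "exponentially_stable (\<lambda>z t. D t z)"
      using linear_stable by (simp add: D_def)
    fix t :: real assume t: "t \<ge> 0"
    show "linear (D t)"
      using matrix_vector_mul_linear[of "?J t 0"] by (simp add: D_J[OF t, abs_def])
    show "norm (D t v) \<le> b * norm v" for v
    proof -
      have "norm (D t v) \<le> norm (?J t 0) * norm v"
        unfolding D_J[OF t] by (rule norm_matrix_vector_mult_le)
      also have "\<dots> \<le> b * norm v"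
        using b[OF t, of 0] r_pos by (intro mult_right_mono) auto
      finally show ?thesis .
    qed
    show "norm (f v t - D t v) \<le> L * (norm v)\<^sup>2" if "norm v < r" for v
      using jacobian_lipschitz_remainder[OF f_diff[OF _ t] L[OF t] that] f_F[of 0 t] r_pos t
      by (simp add: D_J)
  qed (rule r_pos)
  then obtain C c \<delta> where pos: "C > 0" "c > 0" "\<delta> > 0" and
    est: "\<forall>t0\<ge>0. \<forall>t1\<ge>t0. \<forall>z. continuous_on {t0..t1} z \<longrightarrow>
      (\<forall>t\<in>{t0..t1}. norm (z t) < r \<longrightarrow> (z has_vector_derivative f (z t) t) (at t within {t0..t1})) \<longrightarrow>
      norm (z t0) < \<delta> \<longrightarrow> norm (z t1) \<le> C * exp (- c * (t1 - t0)) * norm (z t0)"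
    by (elim exE conjE) (rule that)

  let ?u = "\<lambda>z t. u0 t - K t *v (z - x0 t)"
  have tracks: "J = {t0..} \<and> (\<forall>t\<ge>t0. norm (x t - x0 t) \<le> C * exp (- c * (t - t0)) * norm (x t0 - x0 t0))"
    if t0: "t0 \<ge> 0" and max: "maximal_solution (\<lambda>z t. X z (?u z t)) t0 J x"
      and xM: "x t0 \<in> M" and near: "norm (x t0 - x0 t0) < \<delta>" for t0 J x
  proof -
    have J: "is_interval J" "t0 \<in> J" "J \<subseteq> {t0..}"
      and x_der: "\<And>t. t \<in> J \<Longrightarrow> (x has_vector_derivative X (x t) (?u (x t) t)) (at t within J)"
      using max by (auto simp: maximal_solution_def solution_from_def solution_on_def)
    have bound: "norm (x t1 - x0 t1) \<le> C * exp (- c * (t1 - t0)) * norm (x t0 - x0 t0)"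
      if t1: "t1 \<in> J" for t1
    proof -
      have le: "t0 \<le> t1" using J t1 by auto
      have sub: "{t0..t1} \<subseteq> J" 
        using J(1,2) t1 unfolding is_interval_1 by (meson atLeastAtMost_iff subsetI)
      have sub0: "{t0..t1} \<subseteq> {0..}" using t0 by auto
      have x_der': "(x has_vector_derivative X (x t) (?u (x t) t)) (at t within {t0..t1})"
        if "t \<in> {t0..t1}" for t
        using that sub by (intro has_vector_derivative_within_subset[OF x_der sub]) auto
      have x_cont: "continuous_on {t0..t1} x"
        using x_der' by (meson continuous_on_eq_continuous_within has_vector_derivative_continuous)
      note conts = continuous_on_subset[OF x0_cont sub0] continuous_on_subset[OF u0_cont sub0]
        continuous_on_subset[OF K_cont sub0]
      \<comment> \<open>Along the given trajectory the feedback is a continuous open-loop input, to which the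
          invariance of \<open>M\<close> applies.\<close>
      have in_M: "x t \<in> M" if "t \<in> {t0..t1}" for t
      proof -
        have "continuous_on {t0..t1} (\<lambda>t. ?u (x t) t)"
          by (intro continuous_on_diff continuous_on_matrix_vector_mult conts x_cont)
        moreover have "solution_on (\<lambda>z t. X z (?u (x t) t)) {t0..t1} x"
          using x_der' by (simp add: solution_on_def)
        ultimately show ?thesis
          using M_invariant[unfolded control_invariant_def, rule_format, of t0 t1 "\<lambda>t. ?u (x t) t" x t]
            xM that by blast
      qed
      show ?thesis
      proof (rule est[rule_format, where z = "\<lambda>t. x t - x0 t", OF t0 le])
        show "continuous_on {t0..t1} (\<lambda>t. x t - x0 t)"
          by (intro continuous_on_diff x_cont conts)
        fix t assume t: "t \<in> {t0..t1}" and small: "norm (x t - x0 t) < r"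
        have t': "t \<ge> 0" using t t0 by auto
        have "(x0 has_vector_derivative Xt (x0 t) (u0 t)) (at t within {t0..t1})"
          using x0_solution t' unfolding solution_on_def
          by (intro has_vector_derivative_within_subset[OF _ sub0]) auto
        from has_vector_derivative_diff[OF x_der'[OF t] this]
        show "((\<lambda>t. x t - x0 t) has_vector_derivative f (x t - x0 t) t) (at t within {t0..t1})"
          using f_F[OF small t'] by (simp add: F_def Xt_eq grad0[OF in_M[OF t]])
      qed (rule near)
    qed
    have "J = {t0..}"
    proof (rule maximal_solution_global[OF max])
      have sub0: "{t0..} \<subseteq> {0..}" using t0 by auto
      note conts = continuous_on_subset[OF x0_cont sub0] continuous_on_subset[OF u0_cont sub0]
        continuous_on_subset[OF K_cont sub0]
      show "continuous_on (UNIV \<times> {t0..}) (\<lambda>(z, t). X z (?u z t))"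
        by (intro closed_loop_continuous smooth_on_imp_continuous_on[OF X_smooth] conts)
      show "\<exists>L. \<forall>t\<in>{t0..t1}. \<forall>x\<in>cball 0 R. \<forall>y\<in>cball 0 R.
          norm (X x (?u x t) - X y (?u y t)) \<le> L * norm (x - y)" for R t1
        by (intro closed_loop_locally_lipschitz X_smooth conts)
      fix t1
      have "bounded (x0 ` {t0..t1})"
        by (intro compact_imp_bounded compact_continuous_image continuous_on_subset[OF conts(1)]) auto
      then obtain R where R: "\<And>t. t \<in> {t0..t1} \<Longrightarrow> norm (x0 t) \<le> R"
        unfolding bounded_iff by blast
      have "norm (x t) \<le> R + C * norm (x t0 - x0 t0)" if t: "t \<in> J" "t \<le> t1" for t
      proof -
        have t0t: "t0 \<le> t" using J t by auto
        have "C * exp (- c * (t - t0)) * norm (x t0 - x0 t0) \<le> C * 1 * norm (x t0 - x0 t0)"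
          using pos t0t by (intro mult_right_mono mult_left_mono) (auto simp: mult_nonneg_nonneg)
        then show ?thesis
          using bound[OF t(1)] R[of t] t0t t(2) norm_triangle_sub[of "x t" "x0 t"] by simp
      qed
      then show "\<exists>R. \<forall>t\<in>J. t \<le> t1 \<longrightarrow> norm (x t) \<le> R" by blast
    qed
    then show ?thesis using bound by auto
  qed
  show ?thesis
    unfolding exponentially_tracks_on_def
    by (rule exI[of _ C], rule conjI, rule pos, rule exI[of _ c], rule conjI, rule pos,
        rule exI[of _ \<delta>], rule conjI, rule pos, intro allI impI, rule tracks)
qed

end
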